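(* Let $X$ be a real Banach space which does not contain a closed subspace isomorphic to $\ell_1$ (equivalently, let $X$ be a sequentially reflexive Banach space). Then the Mackey dual $(X^{*},\tau(X^{*},X))$ is an angelic space.
   Context: $X^*$ is the dual of the Banach space $X$. The Mackey topology $\tau(X^*,X)$ on $X^*$ is the topology of uniform convergence on all weakly compact absolutely convex subsets of $X$. A Banach space $X$ is sequentially reflexive if every $\tau(X^*,X)$-convergent sequence in $X^*$ is norm convergent. A Hausdorff topological space $T$ is angelic if every relatively countably compact subset $A$ of $T$ (i.e. every sequence in $A$ has a cluster point in $T$) satisfies: (i) $A$ is relatively compact (its closure in $T$ is compact), and (ii) every $a\in\overline{A}$ is the limit of a sequence in $A$. *)

theory Defs
  imports "HOL-Analysis.Analysis"
begin

section \<open>The sequence space $\ell_1$\<close>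

typedef ell1 = "{a :: nat \<Rightarrow> real. summable (\<lambda>n. \<bar>a n\<bar>)}"
  morphisms ell1_nth Abs_ell1
  by (rule exI[of _ "\<lambda>_. 0"]) simp

setup_lifting type_definition_ell1

lemma summable_abs_ell1_nth [simp]: "summable (\<lambda>n. \<bar>ell1_nth a n\<bar>)"
  using ell1_nth[of a] by simp

instantiation ell1 :: real_normed_vector
begin

lift_definition zero_ell1 :: ell1 is "\<lambda>_. 0"
  by simp

lift_definition plus_ell1 :: "ell1 \<Rightarrow> ell1 \<Rightarrow> ell1" is "\<lambda>a b n. a n + b n"
  subgoal premises prems for a b
    by (rule summable_comparison_test[OF _ summable_add[OF prems]]) (auto intro: abs_triangle_ineq)
  done

lift_definition minus_ell1 :: "ell1 \<Rightarrow> ell1 \<Rightarrow> ell1" is "\<lambda>a b n. a n - b n"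
  subgoal premises prems for a b
    by (rule summable_comparison_test[OF _ summable_add[OF prems]]) (auto intro: abs_triangle_ineq4)
  done

lift_definition uminus_ell1 :: "ell1 \<Rightarrow> ell1" is "\<lambda>a n. - a n"
  by simp

lift_definition scaleR_ell1 :: "real \<Rightarrow> ell1 \<Rightarrow> ell1" is "\<lambda>c a n. c * a n"
  by (simp add: abs_mult summable_mult)

lift_definition norm_ell1 :: "ell1 \<Rightarrow> real" is "\<lambda>a. \<Sum>n. \<bar>a n\<bar>" .

definition dist_ell1 :: "ell1 \<Rightarrow> ell1 \<Rightarrow> real" where
  "dist_ell1 a b = norm (a - b)"

definition sgn_ell1 :: "ell1 \<Rightarrow> ell1" where
  "sgn_ell1 a = inverse (norm a) *\<^sub>R a"

definition uniformity_ell1 :: "(ell1 \<times> ell1) filter" where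
  "uniformity_ell1 = (INF e\<in>{0<..}. principal {(a, b). dist a b < e})"

definition open_ell1 :: "ell1 set \<Rightarrow> bool" where
  "open_ell1 U \<longleftrightarrow> (\<forall>a\<in>U. \<forall>\<^sub>F (a', b) in uniformity. a' = a \<longrightarrow> b \<in> U)"

instance
proof
  fix a b :: ell1 and c :: real
  show "norm a = 0 \<longleftrightarrow> a = 0"
    by transfer (auto simp: suminf_eq_zero_iff)
  show "norm (a + b) \<le> norm a + norm b"
  proof transfer
    fix a b :: "nat \<Rightarrow> real"
    assume ab: "summable (\<lambda>n. \<bar>a n\<bar>)" "summable (\<lambda>n. \<bar>b n\<bar>)"
    have "summable (\<lambda>n. \<bar>a n + b n\<bar>)"
      by (rule summable_comparison_test[OF _ summable_add[OF ab]])
         (auto intro: abs_triangle_ineq)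
    then have "(\<Sum>n. \<bar>a n + b n\<bar>) \<le> (\<Sum>n. \<bar>a n\<bar> + \<bar>b n\<bar>)"
      by (intro suminf_le summable_add ab) (auto intro: abs_triangle_ineq)
    then show "(\<Sum>n. \<bar>a n + b n\<bar>) \<le> (\<Sum>n. \<bar>a n\<bar>) + (\<Sum>n. \<bar>b n\<bar>)"
      by (simp add: suminf_add[OF ab])
  qed
  show "norm (c *\<^sub>R a) = \<bar>c\<bar> * norm a"
    by transfer (simp add: abs_mult suminf_mult)
qed ((rule dist_ell1_def sgn_ell1_def uniformity_ell1_def open_ell1_def)
      | (transfer, simp add: algebra_simps fun_eq_iff))+

end

text \<open>
  The closed subspace \<open>Y\<close> is isomorphic to $\ell_1$ in the sense of Banach spaces, i.e. linearly
  homeomorphic, not necessarily isometric.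
\<close>

definition contains_ell1 :: "'a::real_normed_vector itself \<Rightarrow> bool" where
  "contains_ell1 _ \<longleftrightarrow>
     (\<exists>Y :: 'a set. subspace Y \<and> closed Y \<and>
        (\<exists>(T :: ell1 \<Rightarrow> 'a) S. linear T \<and> homeomorphism UNIV Y T S))"

section \<open>The Mackey topology on the dual\<close>

definition weak_topology :: "'a::real_normed_vector topology" where
  "weak_topology =
     topology_generated_by {blinfun_apply f -` U | (f :: 'a \<Rightarrow>\<^sub>L real) U. open U}"

definition absolutely_convex :: "'a::real_vector set \<Rightarrow> bool" where
  "absolutely_convex K \<longleftrightarrow>
     (\<forall>x\<in>K. \<forall>y\<in>K. \<forall>a b. \<bar>a\<bar> + \<bar>b\<bar> \<le> 1 \<longrightarrow> a *\<^sub>R x + b *\<^sub>R y \<in> K)"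

text \<open>
  The generating sets are the open balls $\{g : \sup_{x \in K} |g(x) - f(x)| < e\}$ of the seminorms
  of uniform convergence on \<open>K\<close>, with the strict bound on the supremum expressed by a \<open>d < e\<close>.
  Lemma \<open>limitin_mackey_topology\<close> below shows that convergence in this topology is uniform
  convergence on each \<open>K\<close>.
\<close>

definition mackey_topology :: "('a::real_normed_vector \<Rightarrow>\<^sub>L real) topology" where
  "mackey_topology =
     topology_generated_by
       {{g. \<exists>d<e. \<forall>x\<in>K. \<bar>blinfun_apply g x - blinfun_apply f x\<bar> \<le> d} | f K e.
          compactin weak_topology K \<and> absolutely_convex K \<and> e > 0}"

lemma topspace_weak_topology [simp]: "topspace (weak_topology :: 'a::real_normed_vector topology) = UNIV"
proof -
  have "UNIV \<in> {blinfun_apply f -` U | (f :: 'a \<Rightarrow>\<^sub>L real) U. open U}"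
    by (auto intro!: exI[of _ UNIV])
  then show ?thesis
    unfolding weak_topology_def topology_generated_by_topspace by (rule Sup_upper[THEN top.extremum_uniqueI])
qed

lemma topspace_mackey_topology [simp]:
  "topspace (mackey_topology :: ('a::real_normed_vector \<Rightarrow>\<^sub>L real) topology) = UNIV"
proof -
  have "f \<in> topspace mackey_topology" for f :: "'a \<Rightarrow>\<^sub>L real"
  proof -
    let ?U = "{g. \<exists>d<1. \<forall>x\<in>{0::'a}. \<bar>blinfun_apply g x - blinfun_apply f x\<bar> \<le> d}"
    have "compactin weak_topology {0::'a} \<and> absolutely_convex {0::'a} \<and> (1::real) > 0"
      by (auto simp: absolutely_convex_def)
    then have "openin mackey_topology ?U"
      unfolding mackey_topology_def
      by (intro topology_generated_by_Basis CollectI exI[of _ f] exI[of _ "{0::'a}"] exI[of _ 1]) simp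
    moreover have "f \<in> ?U"
      by (auto intro: exI[of _ 0])
    ultimately show ?thesis
      using openin_subset by blast
  qed
  then show ?thesis by blast
qed

lemma limitin_mackey_topology:
  fixes s :: "'i \<Rightarrow> ('a::real_normed_vector \<Rightarrow>\<^sub>L real)"
  shows "limitin mackey_topology s l F \<longleftrightarrow>
     (\<forall>K. compactin weak_topology K \<and> absolutely_convex K \<longrightarrow>
        uniform_limit K (\<lambda>i. blinfun_apply (s i)) (blinfun_apply l) F)"
    (is "?L \<longleftrightarrow> ?R")
proof
  assume L: ?L
  show ?R
  proof (intro allI impI uniform_limitI)
    fix K :: "'a set" and e :: real
    assume K: "compactin weak_topology K \<and> absolutely_convex K" and e: "e > 0"
    let ?U = "{g. \<exists>d<e. \<forall>x\<in>K. \<bar>blinfun_apply g x - blinfun_apply l x\<bar> \<le> d}"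
    have "openin mackey_topology ?U"
      unfolding mackey_topology_def using K e by (intro topology_generated_by_Basis CollectI exI[of _ l] exI[of _ K] exI[of _ e]) simp
    moreover have "l \<in> ?U"
      using e by (auto intro: exI[of _ 0])
    ultimately have "\<forall>\<^sub>F i in F. s i \<in> ?U"
      using L unfolding limitin_def by blast
    then show "\<forall>\<^sub>F i in F. \<forall>x\<in>K. dist (blinfun_apply (s i) x) (blinfun_apply l x) < e"
      by eventually_elim (auto simp: dist_real_def intro: le_less_trans)
  qed
next
  assume R: ?R
  have "\<forall>\<^sub>F i in F. s i \<in> U" if "openin mackey_topology U" "l \<in> U" for U
    using that unfolding mackey_topology_def openin_topology_generated_by_iff
  proof (induction rule: generate_topology_on.induct)
    case (Int a b)
    then show ?case by (auto elim: eventually_elim2)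
  next
    case (UN \<K>)
    then obtain V where V: "V \<in> \<K>" "\<forall>\<^sub>F i in F. s i \<in> V" by auto
    show ?case using V(2) by eventually_elim (use V(1) in auto)
  next
    case (Basis V)
    then obtain f K e d where K: "compactin weak_topology K \<and> absolutely_convex K"
      and V: "V = {g. \<exists>d<e. \<forall>x\<in>K. \<bar>blinfun_apply g x - blinfun_apply f x\<bar> \<le> d}"
      and d: "d < e" "\<forall>x\<in>K. \<bar>blinfun_apply l x - blinfun_apply f x\<bar> \<le> d"
      by auto
    have "\<forall>\<^sub>F i in F. \<forall>x\<in>K. dist (blinfun_apply (s i) x) (blinfun_apply l x) < (e - d) / 2"
      using R K d(1) by (intro uniform_limitD) auto
    then show ?case
    proof eventually_elim
      case (elim i)
      have "\<bar>blinfun_apply (s i) x - blinfun_apply f x\<bar> \<le> (e + d) / 2" if "x \<in> K" for x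
        using bspec[OF elim that] bspec[OF d(2) that] unfolding dist_real_def by argo
      moreover have "(e + d) / 2 < e" using d(1) by simp
      ultimately show ?case unfolding V by blast
    qed
  qed auto
  then show ?L by (simp add: limitin_def)
qed

definition sequentially_reflexive :: "'a::real_normed_vector itself \<Rightarrow> bool" where
  "sequentially_reflexive _ \<longleftrightarrow>
     (\<forall>f :: nat \<Rightarrow> 'a \<Rightarrow>\<^sub>L real.
        (\<exists>l. limitin mackey_topology f l sequentially) \<longrightarrow> convergent f)"

section \<open>Angelic spaces\<close>

definition relatively_countably_compactin :: "'a topology \<Rightarrow> 'a set \<Rightarrow> bool" where
  "relatively_countably_compactin T A \<longleftrightarrow>
     A \<subseteq> topspace T \<and>
     (\<forall>s :: nat \<Rightarrow> 'a. range s \<subseteq> A \<longrightarrow>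
        (\<exists>t\<in>topspace T. \<forall>U. openin T U \<and> t \<in> U \<longrightarrow> (\<exists>\<^sub>F n in sequentially. s n \<in> U)))"

definition angelic_space :: "'a topology \<Rightarrow> bool" where
  "angelic_space T \<longleftrightarrow>
     Hausdorff_space T \<and>
     (\<forall>A. relatively_countably_compactin T A \<longrightarrow>
        compactin T (T closure_of A) \<and>
        (\<forall>a \<in> T closure_of A. \<exists>s. range s \<subseteq> A \<and> limitin T s a sequentially))"

end

theory Submission
  imports Defs "HOL-Library.Diagonal_Subsequence"
begin

text \<open>
  If \<open>X\<close> does not contain \<open>\<ell>\<^sub>1\<close>, then by Rosenthal's theorem bounded sequences in \<open>X\<close> have weakly
  Cauchy subsequences. A sequence of functionals that does not tend to 0 in norm is therefore
  already large on a weakly null sequence of differences \<open>y\<close>, hence not uniformly small on the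
  weakly compact set of all \<open>\<Sum>n. a n *\<^sub>R y n\<close> with \<open>(\<Sum>n. \<bar>a n\<bar>) \<le> 1\<close>. Thus Mackey convergent sequences
  converge in norm. The same argument, carried out on the countably many vectors that norm the
  differences \<open>f m - f n\<close>, shows that a relatively countably compact set contains no norm separated
  sequence; it is then relatively norm compact, and on its norm closure both topologies agree.

  Conversely, given a copy of \<open>\<ell>\<^sub>1\<close> with basis \<open>x n\<close>, Hahn--Banach yields for every sign pattern \<open>t\<close> a
  bounded functional \<open>g t\<close> that takes the value \<open>t n\<close> at \<open>x n\<close>. The Rademacher averages
  \<open>f n = \<integral> t n * g t dt\<close> satisfy \<open>f n (x n) = 1\<close>, but tend to 0 uniformly on weakly compact sets, by
  Bessel's inequality and dominated convergence. The integral is replaced by limits of finite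
  averages along an ultrafilter, and dominated convergence by a combinatorial property of finitely
  additive measures, so that no measurability of \<open>g\<close> is needed.
\<close>

section \<open>Ultrafilters and subsequences\<close>

text \<open>Two obstacles shape the first half. A weakly Cauchy sequence need not have a weak limit,
  so weakly compact hulls are built from differences of its terms, and the remaining values at
  earlier terms are disposed of by pointwise convergence. Moreover, countable compactness supplies
  cluster points only, possibly a different one for each subsequence. Hence all vectors norming the
  differences \<open>f m - f n\<close> are shrunk into a single norm null sequence: uniform
  approximation on its hull determines the cluster functional at all those vectors, whichever
  further subsequence is taken. In the second half the functionals \<open>g t\<close> come from
  separate choices, tied together only by a common norm bound and their values at the basis. Only
  finite sets \<open>t\<close> enter the averages. They are countable in number, so a sequence in a
  weakly compact set has a subsequence converging at all these \<open>g t\<close>, and points that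
  agree there agree at every pointwise limit of such functionals. The combinatorial property is
  this: among sets of measure bounded below, infinitely many have the finite intersection
  property.\<close>

definition ultrafilter :: "'a filter \<Rightarrow> bool" where
  "ultrafilter F \<longleftrightarrow> F \<noteq> bot \<and> (\<forall>P. eventually P F \<or> eventually (\<lambda>x. \<not> P x) F)"

text \<open>Zorn's lemma for the reversed order yields a minimal proper filter below
  \<open>F\<close>. If it left \<open>P\<close> undecided, its meet with the principal filter of
  \<open>P\<close> would be proper and strictly smaller.\<close>

lemma ultrafilter_exists:
  fixes F :: "'a filter"
  assumes "F \<noteq> bot"
  obtains G where "G \<le> F" "ultrafilter G"
proof -
  define A where "A = {G :: 'a filter. G \<le> F \<and> G \<noteq> bot}"
  have "\<exists>m\<in>A. \<forall>G\<in>A. G \<le> m \<longrightarrow> G = m"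
  proof (rule predicate_Zorn)
    show "partial_order_on A (relation_of (\<lambda>G H. H \<le> G) A)"
      by (rule partial_order_on_relation_ofI) auto
    fix C assume "C \<in> Chains (relation_of (\<lambda>G H. H \<le> G) A)"
    then have C: "C \<subseteq> A" "\<And>a b. a \<in> C \<Longrightarrow> b \<in> C \<Longrightarrow> a \<le> b \<or> b \<le> a"
      by (auto simp: Chains_def relation_of_def)
    show "\<exists>u\<in>A. \<forall>G\<in>C. u \<le> G"
    proof (cases "C = {}")
      case True
      then show ?thesis using assms by (auto simp: A_def)
    next
      case False
      \<comment> \<open>On a chain no finite meets are needed to describe the infimum, so it is
        proper because every member is.\<close>
      have "eventually P (Inf C) \<longleftrightarrow> (\<exists>b\<in>C. eventually P b)" for P
        by (rule eventually_Inf_base[OF False]) (use C(2) in \<open>metis inf.bounded_iff order_refl\<close>)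
      then have "Inf C \<noteq> bot"
        using C(1) by (auto simp: A_def trivial_limit_def)
      moreover have "Inf C \<le> F"
        using C(1) False by (auto simp: A_def intro: Inf_lower2)
      ultimately show ?thesis by (intro bexI[of _ "Inf C"]) (auto simp: A_def Inf_lower)
    qed
  qed
  then obtain G where G: "G \<in> A" and min: "\<And>K. K \<in> A \<Longrightarrow> K \<le> G \<Longrightarrow> K = G" by blast
  have "eventually P G \<or> eventually (\<lambda>x. \<not> P x) G" for P
  proof (rule ccontr)
    assume *: "\<not> (eventually P G \<or> eventually (\<lambda>x. \<not> P x) G)"
    let ?K = "inf G (principal {x. P x})"
    have "?K \<noteq> bot"
      using * by (auto simp: trivial_limit_def eventually_inf_principal)
    then have "?K = G"
      using G by (intro min) (auto simp: A_def intro: le_infI1)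
    moreover have "eventually P ?K"
      by (simp add: eventually_inf_principal)
    ultimately have "eventually P G" by simp
    with * show False by blast
  qed
  then show ?thesis
    using that[of G] G by (auto simp: A_def ultrafilter_def)
qed

text \<open>One fixed ultrafilter serves both as a notion of largeness and for taking limits. Lying
  below \<open>sequentially\<close> makes it free, so its members are infinite and ultrafilter
  statements can be turned into subsequences.\<close>

definition nat_ultra :: "nat filter" where
  "nat_ultra = (SOME U. U \<le> sequentially \<and> ultrafilter U)"

lemma nat_ultra: "nat_ultra \<le> sequentially" "ultrafilter nat_ultra"
proof -
  obtain U :: "nat filter" where "U \<le> sequentially" "ultrafilter U"
    using ultrafilter_exists[of "sequentially :: nat filter"] by auto
  then have "\<exists>U::nat filter. U \<le> sequentially \<and> ultrafilter U" by blast
  then have "nat_ultra \<le> sequentially \<and> ultrafilter nat_ultra"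
    unfolding nat_ultra_def by (rule someI_ex)
  then show "nat_ultra \<le> sequentially" "ultrafilter nat_ultra" by auto
qed

lemma nat_ultra_nontrivial [simp]: "nat_ultra \<noteq> bot"
  using nat_ultra(2) by (simp add: ultrafilter_def)

lemma eventually_not_nat_ultra: "eventually (\<lambda>n. \<not> P n) nat_ultra \<longleftrightarrow> \<not> eventually P nat_ultra"
proof
  assume "eventually (\<lambda>n. \<not> P n) nat_ultra"
  then show "\<not> eventually P nat_ultra"
    using nat_ultra_nontrivial eventually_elim2[of "\<lambda>n. \<not> P n" nat_ultra P "\<lambda>_. False"]
    by (auto simp: trivial_limit_def)
qed (use nat_ultra(2) in \<open>auto simp: ultrafilter_def\<close>)

lemma eventually_nat_ultraI: "eventually P sequentially \<Longrightarrow> eventually P nat_ultra"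
  using nat_ultra(1) by (rule filter_leD)

lemma eventually_nat_ultra_frequently: "eventually P nat_ultra \<Longrightarrow> frequently P sequentially"
  unfolding frequently_def using eventually_nat_ultraI eventually_not_nat_ultra by blast

text \<open>Compactness of the interval gives a cluster point of the image filter, and an
  ultrafilter converges to each of its cluster points.\<close>

lemma bounded_tendsto_nat_ultra:
  fixes f :: "nat \<Rightarrow> real"
  assumes "\<And>n. \<bar>f n\<bar> \<le> B"
  shows "(f \<longlongrightarrow> Lim nat_ultra f) nat_ultra"
proof -
  have "\<exists>x\<in>cball 0 B. inf (nhds x) (filtermap f nat_ultra) \<noteq> bot"
    using compact_cball[of "0::real" B] unfolding compact_filter
    by (rule allE[of _ "filtermap f nat_ultra"]) (use assms in \<open>auto simp: eventually_filtermap filtermap_bot_iff\<close>)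
  then obtain x where x: "inf (nhds x) (filtermap f nat_ultra) \<noteq> bot" by blast
  have "(f \<longlongrightarrow> x) nat_ultra"
  proof (rule topological_tendstoI, rule ccontr)
    fix S assume S: "open S" "x \<in> S" "\<not> (\<forall>\<^sub>F n in nat_ultra. f n \<in> S)"
    then have "\<forall>\<^sub>F n in nat_ultra. f n \<notin> S"
      by (simp add: eventually_not_nat_ultra)
    then have "\<forall>\<^sub>F y in inf (nhds x) (filtermap f nat_ultra). False"
      unfolding eventually_inf
      by (intro exI[of _ "\<lambda>y. y \<in> S"] exI[of _ "\<lambda>y. y \<notin> S"])
         (use S in \<open>auto simp: eventually_filtermap eventually_nhds\<close>)
    with x show False by (simp add: trivial_limit_def)
  qed
  then show ?thesis
    by (metis tendsto_Lim nat_ultra_nontrivial)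
qed

lemma frequently_subseq:
  assumes "\<And>k. \<exists>\<^sub>F n in sequentially. P k n"
  obtains r :: "nat \<Rightarrow> nat" where "strict_mono r" "\<And>k. P k (r k)"
proof -
  have "\<exists>r :: nat \<Rightarrow> nat. \<forall>k. (\<forall>i<k. r i < r k) \<and> P k (r k)"
  proof (rule dependent_wellorder_choice)
    fix k :: nat and r :: "nat \<Rightarrow> nat"
    have "\<forall>\<^sub>F n in sequentially. \<forall>i\<in>{..<k}. r i < n"
      by (intro eventually_ball_finite) (auto simp: eventually_gt_at_top)
    then have "\<exists>\<^sub>F n in sequentially. P k n \<and> (\<forall>i\<in>{..<k}. r i < n)"
      by (intro frequently_eventually_frequently assms)
    then have "\<exists>n. P k n \<and> (\<forall>i\<in>{..<k}. r i < n)"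
      by (rule frequently_ex)
    then show "\<exists>n. (\<forall>i<k. r i < n) \<and> P k n" by auto
  qed auto
  then show ?thesis using that by (auto simp: strict_mono_def)
qed

lemma frequently_subseq1:
  assumes "\<exists>\<^sub>F n in sequentially. P n"
  obtains r :: "nat \<Rightarrow> nat" where "strict_mono r" "\<And>k. P (r k)"
  using frequently_subseq[of "\<lambda>_. P"] assms by blast

lemma not_tendsto_zero_subseq:
  fixes f :: "nat \<Rightarrow> 'a::real_normed_vector"
  assumes "\<not> f \<longlonglongrightarrow> 0"
  obtains e r where "e > 0" "strict_mono (r :: nat \<Rightarrow> nat)" "\<And>k. norm (f (r k)) \<ge> e"
proof -
  obtain e where e: "e > 0" "\<not> (\<forall>\<^sub>F n in sequentially. norm (f n) < e)"
    using assms unfolding tendsto_iff by (auto simp: dist_norm)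
  then have "\<exists>\<^sub>F n in sequentially. norm (f n) \<ge> e"
    by (simp add: frequently_def not_le)
  then obtain r where "strict_mono (r :: nat \<Rightarrow> nat)" "\<And>k. norm (f (r k)) \<ge> e"
    using frequently_subseq1 by blast
  with e that show ?thesis by blast
qed

section \<open>Rosenthal's theorem\<close>

text \<open>Diagonal intersection: only finitely many sets \<open>W s\<close> concern subsets of
  what has been chosen so far, so their intersection is still large and contains a later
  element.\<close>

lemma fusion:
  assumes W: "\<And>s. finite s \<Longrightarrow> \<forall>\<^sub>F n in nat_ultra. n \<in> W s"
  obtains r :: "nat \<Rightarrow> nat" where "strict_mono r"
    "\<And>s n. \<lbrakk>finite s; s \<subseteq> range r; n \<in> range r; \<And>i. i \<in> s \<Longrightarrow> i < n\<rbrakk> \<Longrightarrow> n \<in> W s"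
proof -
  have "\<exists>r :: nat \<Rightarrow> nat. \<forall>k. (\<forall>i<k. r i < r k) \<and> (\<forall>s\<subseteq>r ` {..<k}. r k \<in> W s)"
  proof (rule dependent_wellorder_choice)
    fix k :: nat and r :: "nat \<Rightarrow> nat"
    have "\<forall>\<^sub>F n in nat_ultra. (\<forall>i\<in>{..<k}. r i < n) \<and> (\<forall>s\<in>Pow (r ` {..<k}). n \<in> W s)"
      by (intro eventually_conj eventually_ball_finite ballI eventually_nat_ultraI[OF eventually_gt_at_top] W)
         (auto intro: finite_subset)
    then have "\<exists>n. (\<forall>i\<in>{..<k}. r i < n) \<and> (\<forall>s\<in>Pow (r ` {..<k}). n \<in> W s)"
      by (rule eventually_happens'[OF nat_ultra_nontrivial])
    then show "\<exists>n. (\<forall>i<k. r i < n) \<and> (\<forall>s\<subseteq>r ` {..<k}. n \<in> W s)" by auto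
  next
    fix n k :: nat and f g :: "nat \<Rightarrow> nat"
    assume "\<And>y. y < k \<Longrightarrow> f y = g y"
    then have "f ` {..<k} = g ` {..<k}" "\<forall>i<k. f i = g i" by auto
    then show "((\<forall>i<k. f i < n) \<and> (\<forall>s\<subseteq>f ` {..<k}. n \<in> W s)) = ((\<forall>i<k. g i < n) \<and> (\<forall>s\<subseteq>g ` {..<k}. n \<in> W s))"
      by auto
  qed
  then obtain r :: "nat \<Rightarrow> nat" where r': "\<forall>k. (\<forall>i<k. r i < r k) \<and> (\<forall>s\<subseteq>r ` {..<k}. r k \<in> W s)" ..
  have r: "r i < r k" if "i < k" for i k using r' that by simp
  have r2: "r k \<in> W s" if "s \<subseteq> r ` {..<k}" for k s using r' that by simp
  have sm: "strict_mono r" using r by (auto simp: strict_mono_def)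
  have "n \<in> W s" if s: "s \<subseteq> range r" and n: "n \<in> range r" and less: "\<And>i. i \<in> s \<Longrightarrow> i < n" for s n
  proof -
    obtain k where k: "n = r k" using n by blast
    have "s \<subseteq> r ` {..<k}"
    proof
      fix i assume i: "i \<in> s"
      then obtain j where j: "i = r j" using s by blast
      with less[OF i] have "j < k" using sm unfolding k by (simp add: strict_mono_less)
      with j show "i \<in> r ` {..<k}" by blast
    qed
    then show ?thesis unfolding k by (rule r2)
  qed
  with sm that show ?thesis by blast
qed

text \<open>
  \<open>acc s\<close> says that \<open>s\<close> can be extended so as to force a member of \<open>\<F>\<close> as long as each next element is
  chosen from an ultrafilter-large set \<open>W\<close> depending on the elements chosen before. Since \<open>acc\<close> or its
  negation passes to ultrafilter-almost all one-point extensions, fusion yields the dichotomy.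
\<close>
theorem galvin:
  fixes \<F> :: "nat set set"
  obtains r :: "nat \<Rightarrow> nat" where "strict_mono r"
    "(\<forall>s. finite s \<and> s \<subseteq> range r \<longrightarrow> s \<notin> \<F>) \<or>
     (\<forall>p. strict_mono p \<and> range p \<subseteq> range r \<longrightarrow> (\<exists>k. p ` {..<k::nat} \<in> \<F>))"
proof -
  \<comment> \<open>\<open>W\<close> is a winning strategy from position \<open>s\<close>: every
    increasing sequence that begins with the elements of \<open>s\<close> and afterwards obeys
    \<open>W\<close> has an initial segment in \<open>\<F>\<close>.\<close>
  define good :: "nat set \<Rightarrow> (nat set \<Rightarrow> nat set) \<Rightarrow> bool" where
    "good s W \<longleftrightarrow> (\<forall>t. finite t \<longrightarrow> (\<forall>\<^sub>F n in nat_ultra. n \<in> W t)) \<and>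
       (\<forall>p. strict_mono p \<and> p ` {..<card s} = s \<and> (\<forall>k\<ge>card s. p k \<in> W (p ` {..<k})) \<longrightarrow> (\<exists>k. p ` {..<k} \<in> \<F>))" for s W
  define acc where "acc s \<longleftrightarrow> (\<exists>W. good s W)" for s
  have acc_mem: "acc s" if "s \<in> \<F>" for s
    unfolding acc_def good_def using that by (intro exI[of _ "\<lambda>_. UNIV"]) (auto intro!: exI[of _ "card s"])
  have acc_step: "acc s" if "finite s" and ev: "\<forall>\<^sub>F n in nat_ultra. acc (insert n s)" for s
  proof -
    \<comment> \<open>The default \<open>UNIV\<close> keeps \<open>V n t\<close> large for every
      finite \<open>t\<close>, also where \<open>insert n s\<close> has no strategy.\<close>
    define V where "V n = (if acc (insert n s) then SOME W. good (insert n s) W else (\<lambda>_. UNIV))" for n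
    have V: "good (insert n s) (V n)" if "acc (insert n s)" for n
      using that someI_ex[of "good (insert n s)"] unfolding V_def acc_def by auto
    have V_ev: "\<forall>\<^sub>F m in nat_ultra. m \<in> V n t" if "finite t" for n t
      using V[of n] that unfolding good_def by (cases "acc (insert n s)") (auto simp: V_def)
    \<comment> \<open>Glueing of strategies: the first move from \<open>s\<close> goes to an
      accepted \<open>n\<close>. Later this \<open>n\<close> is recovered as
      \<open>Min (t - s)\<close>, which tells whose strategy to follow.\<close>
    define W where "W t = (if t = s then {n. acc (insert n s)} else V (Min (t - s)) t)" for t
    have "good s W"
      unfolding good_def
    proof (intro conjI allI impI)
      fix t :: "nat set" assume "finite t"
      then show "\<forall>\<^sub>F n in nat_ultra. n \<in> W t"
        using ev V_ev unfolding W_def by auto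
    next
      fix p assume p: "strict_mono p \<and> p ` {..<card s} = s \<and> (\<forall>k\<ge>card s. p k \<in> W (p ` {..<k}))"
      define n where "n = p (card s)"
      have inj: "inj p" using p strict_mono_imp_inj_on by blast
      have "n \<in> W s" using p unfolding n_def by force
      then have an: "acc (insert n s)" by (simp add: W_def)
      have ins: "n \<notin> s"
        using p inj unfolding n_def by (metis imageE injD lessThan_iff less_irrefl)
      then have card: "card (insert n s) = Suc (card s)"
        using \<open>finite s\<close> by simp
      have im: "p ` {..<card (insert n s)} = insert n s"
        unfolding card using p by (simp add: lessThan_Suc n_def)
      have "p k \<in> V n (p ` {..<k})" if k: "k \<ge> card (insert n s)" for k
      proof -
        have nin: "n \<in> p ` {..<k}" using k card by (auto simp: n_def)
        have "p ` {..<k} - s = p ` {card s..<k}"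
        proof -
          have "{..<k} = {..<card s} \<union> {card s..<k}" using k card by auto
          then have "p ` {..<k} = p ` {..<card s} \<union> p ` {card s..<k}" by (simp add: image_Un)
          then have "p ` {..<k} = s \<union> p ` {card s..<k}" using p by simp
          moreover have "s \<inter> p ` {card s..<k} = {}"
          proof -
            have "p ` {..<card s} \<inter> p ` {card s..<k} = {}"
              unfolding image_Int[OF inj, symmetric] by auto
            then show ?thesis using p by simp
          qed
          ultimately show ?thesis by blast
        qed
        moreover have "Min (p ` {card s..<k}) = n"
        proof (rule Min_eqI)
          show "n \<in> p ` {card s..<k}" using k card by (auto simp: n_def)
          show "n \<le> y" if "y \<in> p ` {card s..<k}" for y
            using that p unfolding n_def by (auto simp: strict_mono_less_eq)
        qed simp
        ultimately have "W (p ` {..<k}) = V n (p ` {..<k})"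
          unfolding W_def using nin ins by auto
        moreover have "k \<ge> card s" using k card by simp
        ultimately show ?thesis using p by metis
      qed
      then show "\<exists>k. p ` {..<k} \<in> \<F>"
        using V[OF an] p im unfolding good_def by blast
    qed
    then show ?thesis unfolding acc_def by blast
  qed
  show ?thesis
  proof (cases "acc {}")
    case True
    then obtain W where W: "good {} W" unfolding acc_def by blast
    then have "\<forall>\<^sub>F n in nat_ultra. n \<in> W t" if "finite t" for t
      using that unfolding good_def by blast
    then obtain r :: "nat \<Rightarrow> nat" where r: "strict_mono r"
      "\<And>s n. \<lbrakk>finite s; s \<subseteq> range r; n \<in> range r; \<And>i. i \<in> s \<Longrightarrow> i < n\<rbrakk> \<Longrightarrow> n \<in> W s"
      by (rule fusion[of W]) blast+
    have "\<exists>k. p ` {..<k} \<in> \<F>" if p: "strict_mono p" "range p \<subseteq> range r" for p :: "nat \<Rightarrow> nat"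
    proof -
      have "p k \<in> W (p ` {..<k})" for k
        using p by (intro r(2)) (auto simp: strict_mono_less)
      then show ?thesis using W p unfolding good_def by simp
    qed
    with r(1) that show ?thesis by blast
  next
    case False
    \<comment> \<open>If \<open>t\<close> is not accepted, then by \<open>acc_step\<close> and the
      ultrafilter property almost all one-point extensions are not accepted either, so rejection of
      the empty set propagates along \<open>r\<close>.\<close>
    define W where "W t = (if acc t then UNIV else {n. \<not> acc (insert n t)})" for t
    have "\<forall>\<^sub>F n in nat_ultra. n \<in> W t" if "finite t" for t
      using acc_step[OF that] by (auto simp: W_def eventually_not_nat_ultra)
    then obtain r :: "nat \<Rightarrow> nat" where r: "strict_mono r"
      "\<And>s n. \<lbrakk>finite s; s \<subseteq> range r; n \<in> range r; \<And>i. i \<in> s \<Longrightarrow> i < n\<rbrakk> \<Longrightarrow> n \<in> W s"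
      by (rule fusion[of W]) blast+
    have "s \<subseteq> range r \<longrightarrow> \<not> acc s" if "finite s" for s
      using that
    proof (induction s rule: finite_linorder_max_induct)
      case (insert n s)
      show ?case
      proof
        assume *: "insert n s \<subseteq> range r"
        then have "n \<in> W s" using insert by (intro r(2)) auto
        then show "\<not> acc (insert n s)"
          using insert * by (simp add: W_def)
      qed
    qed (use False in simp)
    then have "\<forall>s. finite s \<and> s \<subseteq> range r \<longrightarrow> s \<notin> \<F>"
      using acc_mem by blast
    with r(1) that show ?thesis by blast
  qed
qed

text \<open>The odd slots are always occupied; taking or omitting the slot \<open>2*k\<close>
  corrects the parity of the rank of \<open>2*k+1\<close>. Since alternation chooses between two
  sets by parity of rank, every pattern on the odd slots is part of an alternating one.\<close>

lemma parity_prescribed: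
  fixes E :: "nat set"
  shows "\<exists>s\<subseteq>{..<2*k}. (\<forall>i<k. 2*i+1 \<in> s) \<and> (\<forall>i<k. even (card {j\<in>s. j < 2*i+1}) \<longleftrightarrow> i \<in> E)"
proof (induction k)
  case (Suc k)
  then obtain s where s: "s \<subseteq> {..<2*k}" "\<forall>i<k. 2*i+1 \<in> s" "\<forall>i<k. even (card {j\<in>s. j < 2*i+1}) \<longleftrightarrow> i \<in> E"
    by blast
  have fin: "finite s" using s(1) finite_subset by blast
  define s' where "s' = insert (2*k+1) (if even (card s) \<longleftrightarrow> k \<in> E then s else insert (2*k) s)"
  have old: "{j\<in>s'. j < 2*i+1} = {j\<in>s. j < 2*i+1}" if "i < k" for i
    using that unfolding s'_def by auto
  have new: "{j\<in>s'. j < 2*k+1} = (if even (card s) \<longleftrightarrow> k \<in> E then s else insert (2*k) s)"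
    using s(1) unfolding s'_def by auto
  have "2*k \<notin> s" using s(1) by auto
  then have "even (card {j\<in>s'. j < 2*k+1}) \<longleftrightarrow> k \<in> E"
    unfolding new using fin by auto
  then have "\<forall>i<Suc k. even (card {j\<in>s'. j < 2*i+1}) \<longleftrightarrow> i \<in> E"
    using s(3) old by (auto simp: less_Suc_eq)
  moreover have "\<forall>i<Suc k. 2*i+1 \<in> s'"
    using s(2) unfolding s'_def by (auto simp: less_Suc_eq)
  moreover have "s' \<subseteq> {..<2*Suc k}"
    using s(1) unfolding s'_def by auto
  ultimately show ?case by blast
qed simp

text \<open>
  Galvin's lemma is applied to the finite sets of indices along which no point alternates between
  \<open>A\<close> and \<open>B\<close>; keeping only every second index then leaves room to realise any pattern.
\<close>
theorem independent_subsequence: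
  fixes A B :: "nat \<Rightarrow> 's set"
  assumes "\<And>r. strict_mono r \<Longrightarrow> \<exists>x\<in>S. (\<exists>\<^sub>F k in sequentially. x \<in> A (r k)) \<and> (\<exists>\<^sub>F k in sequentially. x \<in> B (r k))"
  obtains r :: "nat \<Rightarrow> nat" where "strict_mono r"
    "\<And>(k::nat) E. \<exists>x\<in>S. \<forall>i<k. if i \<in> E then x \<in> A (r i) else x \<in> B (r i)"
proof -
  define alt where "alt s x \<longleftrightarrow> (\<forall>n\<in>s. if even (card {i\<in>s. i < n}) then x \<in> A n else x \<in> B n)" for s :: "nat set" and x
  obtain r :: "nat \<Rightarrow> nat" where r: "strict_mono r" and
    dich: "(\<forall>s. finite s \<and> s \<subseteq> range r \<longrightarrow> s \<notin> {s. \<not> (\<exists>x\<in>S. alt s x)}) \<or>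
     (\<forall>p. strict_mono p \<and> range p \<subseteq> range r \<longrightarrow> (\<exists>k. p ` {..<k::nat} \<in> {s. \<not> (\<exists>x\<in>S. alt s x)}))"
    by (rule galvin)
  \<comment> \<open>The second alternative is refuted by a point that lies infinitely often in each
    of \<open>A\<close> and \<open>B\<close> along \<open>r\<close>: it alternates along a suitable
    subsequence, so no initial segment of that subsequence is bad.\<close>
  have "\<not> (\<forall>p. strict_mono p \<and> range p \<subseteq> range r \<longrightarrow> (\<exists>k. p ` {..<k::nat} \<in> {s. \<not> (\<exists>x\<in>S. alt s x)}))"
  proof -
    obtain x where x: "x \<in> S" "\<exists>\<^sub>F k in sequentially. x \<in> A (r k)" "\<exists>\<^sub>F k in sequentially. x \<in> B (r k)"
      using assms[OF r] by blast
    have "\<exists>\<^sub>F n in sequentially. if even k then x \<in> A (r n) else x \<in> B (r n)" for k :: nat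
      using x by (cases "even k") simp_all
    then obtain q :: "nat \<Rightarrow> nat" where q: "strict_mono q" "\<And>k. if even k then x \<in> A (r (q k)) else x \<in> B (r (q k))"
      using frequently_subseq[of "\<lambda>k n. if even k then x \<in> A (r n) else x \<in> B (r n)"] by blast
    define p where "p = r \<circ> q"
    have p: "strict_mono p" unfolding p_def using r q(1) by (rule strict_mono_o)
    have "alt (p ` {..<k}) x" for k
      unfolding alt_def
    proof
      fix n assume "n \<in> p ` {..<k}"
      then obtain j where j: "n = p j" "j < k" by auto
      have "{i \<in> p ` {..<k}. i < n} = p ` {..<j}"
        using j p by (auto simp: strict_mono_less)
      then have "card {i \<in> p ` {..<k}. i < n} = j"
        using card_image[OF inj_on_subset[OF strict_mono_imp_inj_on[OF p] subset_UNIV]] by simp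
      then show "if even (card {i \<in> p ` {..<k}. i < n}) then x \<in> A n else x \<in> B n"
        using q(2)[of j] by (simp add: j p_def)
    qed
    then have "\<forall>k. \<exists>x\<in>S. alt (p ` {..<k}) x" using x(1) by blast
    moreover have "range p \<subseteq> range r" unfolding p_def by auto
    ultimately show ?thesis using p by (auto intro!: exI[of _ p])
  qed
  with dich have fin: "\<exists>x\<in>S. alt s x" if "finite s" "s \<subseteq> range r" for s
    using that by blast
  define r' where "r' i = r (2*i+1)" for i
  have "\<exists>x\<in>S. \<forall>i<k. if i \<in> E then x \<in> A (r' i) else x \<in> B (r' i)" for k E
  proof -
    obtain s where s: "s\<subseteq>{..<2*k}" "\<forall>i<k. 2*i+1 \<in> s" "\<forall>i<k. even (card {j\<in>s. j < 2*i+1}) \<longleftrightarrow> i \<in> E"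
      using parity_prescribed[of k E] by blast
    have "finite s" using s(1) finite_subset by blast
    then obtain x where x: "x \<in> S" "alt (r ` s) x" using fin[of "r ` s"] by auto
    have "if i \<in> E then x \<in> A (r' i) else x \<in> B (r' i)" if "i < k" for i
    proof -
      have "{j \<in> r ` s. j < r (2*i+1)} = r ` {j\<in>s. j < 2*i+1}"
        using r by (auto simp: strict_mono_less)
      then have "card {j \<in> r ` s. j < r (2*i+1)} = card {j\<in>s. j < 2*i+1}"
        using card_image[OF inj_on_subset[OF strict_mono_imp_inj_on[OF r] subset_UNIV]] by simp
      then have "even (card {j \<in> r ` s. j < r (2*i+1)}) \<longleftrightarrow> i \<in> E"
        using s(3) that by simp
      moreover have "r (2*i+1) \<in> r ` s" using s(2) that by blast
      ultimately show ?thesis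
        using bspec[OF x(2)[unfolded alt_def], of "r (2*i+1)"] unfolding r'_def by presburger
    qed
    with x(1) show ?thesis by blast
  qed
  moreover have "strict_mono r'"
    using r unfolding r'_def strict_mono_def by auto
  ultimately show ?thesis using that by blast
qed

section \<open>Oscillation, diagonal subsequences and the dichotomy for bounded sequences\<close>

text \<open>The values come close to the ultrafilter limit \<open>l\<close> infinitely often, and
  infinitely often stay at distance \<open>e\<close> on one fixed side of it; two rationals fit in
  between. Rationality leaves only countably many pairs to diagonalise over.\<close>

lemma real_oscillation:
  fixes f :: "nat \<Rightarrow> real"
  assumes bd: "\<And>n. \<bar>f n\<bar> \<le> B" and nc: "\<not> convergent f"
  obtains a b :: rat where "a < b" "\<exists>\<^sub>F n in sequentially. f n < of_rat a" "\<exists>\<^sub>F n in sequentially. f n > of_rat b"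
proof -
  define l where "l = Lim nat_ultra f"
  have l: "(f \<longlongrightarrow> l) nat_ultra"
    unfolding l_def by (rule bounded_tendsto_nat_ultra[OF bd])
  obtain e where e: "e > 0" "\<not> (\<forall>\<^sub>F n in sequentially. dist (f n) l < e)"
    using nc unfolding convergent_def tendsto_iff by metis
  then have "\<exists>\<^sub>F n in sequentially. f n \<ge> l + e \<or> f n \<le> l - e"
    unfolding frequently_def by (simp add: dist_real_def abs_less_iff not_le algebra_simps)
  then consider "\<exists>\<^sub>F n in sequentially. f n \<ge> l + e" | "\<exists>\<^sub>F n in sequentially. f n \<le> l - e"
    by (auto simp: frequently_disj_iff)
  then show ?thesis
  proof cases
    case 1
    obtain a :: rat where a: "l < of_rat a" "of_rat a < l + e"
      using of_rat_dense[of l "l + e"] e(1) by auto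
    obtain b :: rat where b: "of_rat a < (of_rat b :: real)" "of_rat b < l + e"
      using of_rat_dense[OF a(2)] by auto
    have "\<forall>\<^sub>F n in nat_ultra. f n < of_rat a"
      using l a(1) by (rule order_tendstoD)
    moreover have "\<exists>\<^sub>F n in sequentially. f n > of_rat b"
      using 1 by (rule frequently_elim1) (use b in auto)
    ultimately show ?thesis
      using that[of a b] b(1) by (auto simp: of_rat_less dest: eventually_nat_ultra_frequently)
  next
    case 2
    obtain b :: rat where b: "l - e < of_rat b" "of_rat b < l"
      using of_rat_dense[of "l - e" l] e(1) by auto
    obtain a :: rat where a: "l - e < of_rat a" "of_rat a < (of_rat b :: real)"
      using of_rat_dense[OF b(1)] by auto
    have "\<forall>\<^sub>F n in nat_ultra. of_rat b < f n"
      using l b(2) by (rule order_tendstoD)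
    moreover have "\<exists>\<^sub>F n in sequentially. f n < of_rat a"
      using 2 by (rule frequently_elim1) (use a in auto)
    ultimately show ?thesis
      using that[of a b] a(2) by (auto simp: of_rat_less dest: eventually_nat_ultra_frequently)
  qed
qed

lemma frequently_subseqD:
  assumes "strict_mono (r :: nat \<Rightarrow> nat)" "\<exists>\<^sub>F k in sequentially. P (r k)"
  shows "\<exists>\<^sub>F k in sequentially. P k"
  using assms(2) eventually_subseq[OF assms(1), of "\<lambda>k. \<not> P k"] by (auto simp: frequently_def)

text \<open>Without \<open>osc\<close>, every subsequence has, for each rational pair, a further
  subsequence along which no point of \<open>S\<close> oscillates across that pair. Diagonalising
  over all pairs leaves no oscillation at all, hence pointwise convergence.\<close>

lemma pointwise_convergent_or_oscillating:
  fixes f :: "nat \<Rightarrow> 's \<Rightarrow> real"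
  assumes bd: "\<And>x n. x \<in> S \<Longrightarrow> \<bar>f n x\<bar> \<le> B x"
  obtains (conv) r :: "nat \<Rightarrow> nat" where "strict_mono r" "\<And>x. x \<in> S \<Longrightarrow> convergent (\<lambda>n. f (r n) x)"
    | (osc) r :: "nat \<Rightarrow> nat" and a b where "strict_mono r" "a < b"
      "\<And>q :: nat \<Rightarrow> nat. strict_mono q \<Longrightarrow> \<exists>x\<in>S. (\<exists>\<^sub>F n in sequentially. f (r (q n)) x > b) \<and> (\<exists>\<^sub>F n in sequentially. f (r (q n)) x < a)"
proof (rule ccontr)
  assume no: "\<not> thesis"
  define P :: "nat \<Rightarrow> (nat \<Rightarrow> nat) \<Rightarrow> bool" where
    "P k s \<longleftrightarrow> (case from_nat k of (a, b) \<Rightarrow> (a::rat) < b \<longrightarrow>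
       (\<forall>x\<in>S. \<not> ((\<exists>\<^sub>F n in sequentially. f (s n) x > of_rat b) \<and> (\<exists>\<^sub>F n in sequentially. f (s n) x < of_rat a))))" for k s
  interpret subseqs P
  proof
    fix k and s :: "nat \<Rightarrow> nat" assume s: "strict_mono s"
    obtain a b :: rat where ab: "from_nat k = (a, b)" by (cases "from_nat k :: rat \<times> rat")
    show "\<exists>r'. strict_mono r' \<and> P k (s \<circ> r')"
    proof (cases "a < b")
      case True
      then have "(of_rat a :: real) < of_rat b" by (simp add: of_rat_less)
      with no osc[OF s this] show ?thesis
        unfolding P_def by (auto simp: ab)
    next
      case False
      then show ?thesis unfolding P_def by (auto simp: ab intro!: exI[of _ id] strict_mono_id)
    qed
  qed
  \<comment> \<open>The diagonal sequence refines the \<open>k\<close>-th stage only from some index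
    on, so the property must pass to subsequences; a shift of the index then does not affect
    \<open>frequently\<close>.\<close>
  have stable: "P k (s \<circ> r)" if "strict_mono r" "P k s" for k r s
  proof -
    obtain a b :: rat where ab: "from_nat k = (a, b)" by (cases "from_nat k :: rat \<times> rat")
    show ?thesis
      using that(2) frequently_subseqD[OF that(1), of "\<lambda>n. of_rat b < f (s n) x" for x]
        frequently_subseqD[OF that(1), of "\<lambda>n. f (s n) x < of_rat a" for x]
      unfolding P_def ab by auto
  qed
  have "convergent (\<lambda>n. f (diagseq n) x)" if x: "x \<in> S" for x
  proof (rule ccontr)
    assume "\<not> convergent (\<lambda>n. f (diagseq n) x)"
    then obtain a b :: rat where ab: "a < b" "\<exists>\<^sub>F n in sequentially. f (diagseq n) x < of_rat a" "\<exists>\<^sub>F n in sequentially. f (diagseq n) x > of_rat b"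
      using real_oscillation[OF bd[OF x]] by blast
    define k where "k = to_nat (a, b)"
    have "P k (diagseq \<circ> (+) (Suc k))" using stable by (rule diagseq_holds)
    moreover have "\<exists>\<^sub>F n in sequentially. Q (Suc k + n)" if "\<exists>\<^sub>F n in sequentially. Q n" for Q
      using that unfolding frequently_def by (subst add.commute) (simp add: eventually_sequentially_seg[of "\<lambda>n. \<not> Q n"] del: add_Suc_right)
    ultimately show False
      using ab x unfolding P_def k_def by auto
  qed
  with no conv[OF subseq_diagseq] show False by blast
qed

text \<open>Since \<open>a\<close> and \<open>b\<close> may have the same sign, one functional gives
  no bound. In the difference \<open>f - g\<close> of opposite patterns each term contributes at
  least \<open>b - a\<close> times the modulus of its coefficient, and the norm of
  \<open>f - g\<close> is at most 2.\<close>

lemma sum_sign_lower_bound: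
  fixes x :: "nat \<Rightarrow> 'a::real_normed_vector" and f g :: "'a \<Rightarrow>\<^sub>L real"
  assumes "norm f \<le> 1" "norm g \<le> 1" "a < b"
    and f: "\<And>i. i < k \<Longrightarrow> if c i \<ge> 0 then f (x i) > b else f (x i) < a"
    and g: "\<And>i. i < k \<Longrightarrow> if c i \<ge> 0 then g (x i) < a else g (x i) > b"
  shows "(b - a) / 2 * (\<Sum>i<k. \<bar>c i\<bar>) \<le> norm (\<Sum>i<k. c i *\<^sub>R x i)"
proof -
  let ?y = "\<Sum>i<k. c i *\<^sub>R x i"
  have "(b - a) * (\<Sum>i<k. \<bar>c i\<bar>) = (\<Sum>i<k. \<bar>c i\<bar> * (b - a))"
    by (simp add: sum_distrib_left mult.commute)
  also have "\<dots> \<le> (\<Sum>i<k. c i * (f (x i) - g (x i)))"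
  proof (rule sum_mono)
    fix i assume "i \<in> {..<k}"
    then have i: "i < k" by simp
    show "\<bar>c i\<bar> * (b - a) \<le> c i * (f (x i) - g (x i))"
    proof (cases "c i \<ge> 0")
      case True
      then have "c i * (b - a) \<le> c i * (f (x i) - g (x i))"
        using f[OF i] g[OF i] by (intro mult_left_mono) auto
      with True show ?thesis by simp
    next
      case False
      then have "(- c i) * (b - a) \<le> (- c i) * (g (x i) - f (x i))"
        using f[OF i] g[OF i] by (intro mult_left_mono) auto
      with False show ?thesis by (simp add: algebra_simps)
    qed
  qed
  also have "\<dots> = f ?y - g ?y"
    by (simp add: blinfun.sum_right blinfun.scaleR_right right_diff_distrib sum_subtractf)
  also have "\<dots> \<le> norm ?y + norm ?y"
  proof -
    have "\<bar>h ?y\<bar> \<le> norm ?y" if "norm h \<le> 1" for h :: "'a \<Rightarrow>\<^sub>L real"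
      using norm_blinfun[of h ?y] mult_right_mono[OF that norm_ge_zero[of ?y]] by simp
    from this[OF assms(1)] this[OF assms(2)] show ?thesis by linarith
  qed
  finally show ?thesis by simp
qed

text \<open>The vectors \<open>x n\<close> are viewed as functions on the dual unit ball. In the
  oscillating case the sets where \<open>x n\<close> exceeds \<open>b\<close> or falls below
  \<open>a\<close> contain an independent sequence, and the signs of the coefficients prescribe the
  pattern.\<close>

theorem rosenthal_dichotomy:
  fixes x :: "nat \<Rightarrow> 'a::real_normed_vector"
  assumes bd: "\<And>n. norm (x n) \<le> B"
  obtains (weakly_Cauchy) r where "strict_mono (r :: nat \<Rightarrow> nat)" "\<And>f :: 'a \<Rightarrow>\<^sub>L real. convergent (\<lambda>n. f (x (r n)))"
    | (ell1_basis) r d where "strict_mono (r :: nat \<Rightarrow> nat)" "d > 0"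
      "\<And>c k. d * (\<Sum>i<k::nat. \<bar>c i\<bar>) \<le> norm (\<Sum>i<k. c i *\<^sub>R x (r i))"
proof -
  let ?S = "{f :: 'a \<Rightarrow>\<^sub>L real. norm f \<le> 1}"
  have bdd: "\<bar>f (x n)\<bar> \<le> norm f * B" for f :: "'a \<Rightarrow>\<^sub>L real" and n
    using norm_blinfun[of f "x n"] mult_left_mono[OF bd[of n] norm_ge_zero[of f]] by simp
  show thesis
  proof (rule pointwise_convergent_or_oscillating[of ?S "\<lambda>n f. blinfun_apply f (x n)" "\<lambda>f. norm f * B"])
    fix r :: "nat \<Rightarrow> nat"
    assume r: "strict_mono r" and conv: "\<And>f. f \<in> ?S \<Longrightarrow> convergent (\<lambda>n. blinfun_apply f (x (r n)))"
    have "convergent (\<lambda>n. f (x (r n)))" for f :: "'a \<Rightarrow>\<^sub>L real"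
    proof (cases "f = 0")
      case True
      then show ?thesis by (simp add: convergent_const)
    next
      case False
      then have "convergent (\<lambda>n. norm f * ((inverse (norm f) *\<^sub>R f) (x (r n))))"
        by (intro convergent_mult convergent_const conv) simp
      moreover have "norm f * ((inverse (norm f) *\<^sub>R f) (x (r n))) = f (x (r n))" for n
        using False by (simp add: blinfun.scaleR_left field_simps)
      ultimately show ?thesis by simp
    qed
    with r show thesis by (rule weakly_Cauchy)
  next
    fix r :: "nat \<Rightarrow> nat" and a b :: real
    assume r: "strict_mono r" and ab: "a < b"
      and osc: "\<And>q :: nat \<Rightarrow> nat. strict_mono q \<Longrightarrow>
        \<exists>f\<in>?S. (\<exists>\<^sub>F n in sequentially. blinfun_apply f (x (r (q n))) > b) \<and> (\<exists>\<^sub>F n in sequentially. blinfun_apply f (x (r (q n))) < a)"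
    obtain q :: "nat \<Rightarrow> nat" where q: "strict_mono q" and indep: "\<And>(k::nat) E. \<exists>f\<in>?S. \<forall>i<k.
        if i \<in> E then f \<in> {f. blinfun_apply f (x (r (q i))) > b} else f \<in> {f. blinfun_apply f (x (r (q i))) < a}"
      using independent_subsequence[of ?S "\<lambda>n. {f. blinfun_apply f (x (r n)) > b}" "\<lambda>n. {f. blinfun_apply f (x (r n)) < a}"] osc
      by auto
    have "(b - a) / 2 * (\<Sum>i<k. \<bar>c i\<bar>) \<le> norm (\<Sum>i<k. c i *\<^sub>R x ((r \<circ> q) i))" for c and k :: nat
    proof -
      obtain f where f: "norm f \<le> 1" "\<forall>i<k. if c i \<ge> 0 then blinfun_apply f (x (r (q i))) > b else f (x (r (q i))) < a"
        using indep[of k "{i. c i \<ge> 0}", unfolded mem_Collect_eq] by blast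
      obtain g where g: "norm g \<le> 1" "\<forall>i<k. if c i < 0 then blinfun_apply g (x (r (q i))) > b else g (x (r (q i))) < a"
        using indep[of k "{i. c i < 0}", unfolded mem_Collect_eq] by blast
      show ?thesis
        by (rule sum_sign_lower_bound[OF f(1) g(1) ab]) (use f(2) g(2) in \<open>auto split: if_splits\<close>)
    qed
    with strict_mono_o[OF r q] ab show thesis
      by (intro ell1_basis[of "r \<circ> q" "(b - a) / 2"]) auto
  qed (use bdd in auto)
qed

section \<open>Copies of $\ell_1$\<close>

lemma sum_le_norm_ell1: "(\<Sum>i<n. \<bar>ell1_nth a i\<bar>) \<le> norm a"
  unfolding norm_ell1.rep_eq by (rule sum_le_suminf) auto

lemma norm_ell1_leI: "(\<And>n. (\<Sum>i<n. \<bar>ell1_nth a i\<bar>) \<le> C) \<Longrightarrow> norm a \<le> C"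
  unfolding norm_ell1.rep_eq by (intro suminf_le_const) auto

lemma abs_ell1_nth_le: "\<bar>ell1_nth a i\<bar> \<le> norm a"
proof -
  have "\<bar>ell1_nth a i\<bar> \<le> (\<Sum>i<Suc i. \<bar>ell1_nth a i\<bar>)"
    by (rule member_le_sum) auto
  also have "\<dots> \<le> norm a" by (rule sum_le_norm_ell1)
  finally show ?thesis .
qed

lemma complete_ell1: "complete (UNIV :: ell1 set)"
  unfolding complete_def
proof (intro allI impI)
  fix a :: "nat \<Rightarrow> ell1" assume "(\<forall>n. a n \<in> UNIV) \<and> Cauchy a"
  then have C: "Cauchy a" by simp
  have "Cauchy (\<lambda>n. ell1_nth (a n) i)" for i
  proof (rule metric_CauchyI)
    fix e :: real assume "e > 0"
    then obtain M where M: "\<And>m n. m \<ge> M \<Longrightarrow> n \<ge> M \<Longrightarrow> dist (a m) (a n) < e"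
      using metric_CauchyD[OF C] by blast
    have "dist (ell1_nth (a m) i) (ell1_nth (a n) i) < e" if "m \<ge> M" "n \<ge> M" for m n
      using abs_ell1_nth_le[of "a m - a n" i] M[OF that] by (simp add: dist_real_def dist_norm minus_ell1.rep_eq)
    then show "\<exists>M. \<forall>m\<ge>M. \<forall>n\<ge>M. dist (ell1_nth (a m) i) (ell1_nth (a n) i) < e" by blast
  qed
  then have conv: "convergent (\<lambda>n. ell1_nth (a n) i)" for i
    by (simp add: Cauchy_convergent_iff)
  define b where "b i = lim (\<lambda>n. ell1_nth (a n) i)" for i
  have b: "(\<lambda>n. ell1_nth (a n) i) \<longlonglongrightarrow> b i" for i
    unfolding b_def using conv by (simp add: convergent_LIMSEQ_iff)
  \<comment> \<open>Uniformity in \<open>k\<close> lets this estimate give both the summability of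
    the coordinatewise limit, with \<open>e = 1\<close>, and convergence in norm.\<close>
  have key: "\<exists>M::nat. \<forall>m\<ge>M. \<forall>k. (\<Sum>i<k. \<bar>ell1_nth (a m) i - b i\<bar>) \<le> e" if e: "e > 0" for e
  proof -
    obtain M where M: "\<And>m n. m \<ge> M \<Longrightarrow> n \<ge> M \<Longrightarrow> dist (a m) (a n) < e"
      using metric_CauchyD[OF C e] by blast
    have "(\<Sum>i<k. \<bar>ell1_nth (a m) i - b i\<bar>) \<le> e" if m: "m \<ge> M" for m k
    proof (rule tendsto_upperbound)
      show "(\<lambda>n. \<Sum>i<k. \<bar>ell1_nth (a m) i - ell1_nth (a n) i\<bar>) \<longlonglongrightarrow> (\<Sum>i<k. \<bar>ell1_nth (a m) i - b i\<bar>)"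
        by (intro tendsto_intros b)
      show "\<forall>\<^sub>F n in sequentially. (\<Sum>i<k. \<bar>ell1_nth (a m) i - ell1_nth (a n) i\<bar>) \<le> e"
        using eventually_ge_at_top[of M]
      proof eventually_elim
        case (elim n)
        then show ?case
          using sum_le_norm_ell1[of "a m - a n" k] M[OF m elim] by (simp add: dist_norm minus_ell1.rep_eq)
      qed
    qed simp
    then show ?thesis by blast
  qed
  obtain M where M: "\<And>k. (\<Sum>i<k. \<bar>ell1_nth (a M) i - b i\<bar>) \<le> 1" using key[of 1] by auto
  have "summable (\<lambda>i. \<bar>b i\<bar>)"
  proof (rule bounded_imp_summable)
    fix k
    have "(\<Sum>i\<le>k. \<bar>b i\<bar>) \<le> (\<Sum>i\<le>k. \<bar>ell1_nth (a M) i - b i\<bar> + \<bar>ell1_nth (a M) i\<bar>)"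
      by (rule sum_mono) auto
    also have "\<dots> \<le> 1 + norm (a M)"
      using M[of "Suc k"] sum_le_norm_ell1[of "a M" "Suc k"] by (simp add: sum.distrib lessThan_Suc_atMost)
    finally show "(\<Sum>i\<le>k. \<bar>b i\<bar>) \<le> 1 + norm (a M)" .
  qed simp
  then have nth: "ell1_nth (Abs_ell1 b) = b" by (simp add: Abs_ell1_inverse)
  have "a \<longlonglongrightarrow> Abs_ell1 b"
  proof (rule metric_LIMSEQ_I)
    fix e :: real assume "e > 0"
    then obtain M where "\<forall>m\<ge>M. \<forall>k. (\<Sum>i<k. \<bar>ell1_nth (a m) i - b i\<bar>) \<le> e / 2" using key[of "e / 2"] by auto
    then have "norm (a m - Abs_ell1 b) \<le> e / 2" if "m \<ge> M" for m
      using that by (intro norm_ell1_leI) (simp add: minus_ell1.rep_eq nth)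
    then have "\<forall>m\<ge>M. dist (a m) (Abs_ell1 b) < e" using \<open>e > 0\<close> by (force simp: dist_norm)
    then show "\<exists>M. \<forall>m\<ge>M. dist (a m) (Abs_ell1 b) < e" by blast
  qed
  then show "\<exists>l\<in>UNIV. a \<longlonglongrightarrow> l" by blast
qed

lemma summable_scaleR_bounded:
  fixes x :: "nat \<Rightarrow> 'a::banach"
  assumes "\<And>n. norm (x n) \<le> B" "summable (\<lambda>n. \<bar>a n\<bar>)"
  shows "summable (\<lambda>n. a n *\<^sub>R x n)" "norm (\<Sum>n. a n *\<^sub>R x n) \<le> (\<Sum>n. \<bar>a n\<bar>) * B"
proof -
  have le: "norm (a n *\<^sub>R x n) \<le> \<bar>a n\<bar> * B" for n
    using mult_left_mono[OF assms(1)[of n] abs_ge_zero[of "a n"]] by simp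
  have sB: "summable (\<lambda>n. \<bar>a n\<bar> * B)" using assms(2) by (rule summable_mult2)
  then have sn: "summable (\<lambda>n. norm (a n *\<^sub>R x n))"
    by (rule summable_comparison_test'[of _ 0]) (use le in auto)
  then show "summable (\<lambda>n. a n *\<^sub>R x n)" by (rule summable_norm_cancel)
  have "norm (\<Sum>n. a n *\<^sub>R x n) \<le> (\<Sum>n. norm (a n *\<^sub>R x n))"
    using sn by (rule summable_norm)
  also have "\<dots> \<le> (\<Sum>n. \<bar>a n\<bar> * B)" by (rule suminf_le[OF le sn sB])
  also have "\<dots> = (\<Sum>n. \<bar>a n\<bar>) * B" using suminf_mult2[OF assms(2)] by simp
  finally show "norm (\<Sum>n. a n *\<^sub>R x n) \<le> (\<Sum>n. \<bar>a n\<bar>) * B" .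
qed

lemma bounded_linear_ell1_sum:
  fixes x :: "nat \<Rightarrow> 'a::banach"
  assumes bd: "\<And>n. norm (x n) \<le> B"
  shows "bounded_linear (\<lambda>a. \<Sum>n. ell1_nth a n *\<^sub>R x n)"
    and "norm (\<Sum>n. ell1_nth a n *\<^sub>R x n) \<le> norm a * B"
proof -
  note summ = summable_scaleR_bounded(1)[OF bd summable_abs_ell1_nth]
  show le: "norm (\<Sum>n. ell1_nth a n *\<^sub>R x n) \<le> norm a * B" for a
    unfolding norm_ell1.rep_eq by (rule summable_scaleR_bounded(2)[OF bd summable_abs_ell1_nth])
  show "bounded_linear (\<lambda>a. \<Sum>n. ell1_nth a n *\<^sub>R x n)"
  proof (rule bounded_linear_intro)
    show "(\<Sum>n. ell1_nth (a + b) n *\<^sub>R x n) = (\<Sum>n. ell1_nth a n *\<^sub>R x n) + (\<Sum>n. ell1_nth b n *\<^sub>R x n)" for a b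
      by (simp add: plus_ell1.rep_eq scaleR_add_left suminf_add[OF summ summ])
    show "(\<Sum>n. ell1_nth (r *\<^sub>R a) n *\<^sub>R x n) = r *\<^sub>R (\<Sum>n. ell1_nth a n *\<^sub>R x n)" for r a
      using suminf_scaleR_right[OF summ[of a], of r] by (simp add: scaleR_ell1.rep_eq)
  qed (rule le)
qed

text \<open>The synthesis map with coefficients in \<open>ell1\<close> inherits the lower bound in
  the limit, so its inverse is Lipschitz and completeness of \<open>ell1\<close> makes its range
  closed.\<close>

lemma contains_ell1I:
  fixes x :: "nat \<Rightarrow> 'a::banach"
  assumes bd: "\<And>n. norm (x n) \<le> B" and d: "d > 0"
    and lower: "\<And>c k. d * (\<Sum>i<k::nat. \<bar>c i\<bar>) \<le> norm (\<Sum>i<k. c i *\<^sub>R x i)"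
  shows "contains_ell1 TYPE('a)"
proof -
  define T where "T a = (\<Sum>n. ell1_nth a n *\<^sub>R x n)" for a
  note summ = summable_scaleR_bounded(1)[OF bd summable_abs_ell1_nth]
  have T: "bounded_linear T"
    unfolding T_def by (rule bounded_linear_ell1_sum(1)[OF bd])
  have Tlow: "d * norm a \<le> norm (T a)" for a
  proof (rule LIMSEQ_le)
    show "(\<lambda>k. d * (\<Sum>i<k. \<bar>ell1_nth a i\<bar>)) \<longlonglongrightarrow> d * norm a"
      unfolding norm_ell1.rep_eq by (intro tendsto_mult tendsto_const summable_LIMSEQ) auto
    show "(\<lambda>k. norm (\<Sum>i<k. ell1_nth a i *\<^sub>R x i)) \<longlonglongrightarrow> norm (T a)"
      unfolding T_def by (intro tendsto_norm summable_LIMSEQ summ)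
  qed (use lower in auto)
  have lin: "linear T" using T by (rule bounded_linear.linear)
  have inj: "inj T"
  proof (rule linear_injective_0[OF lin, THEN iffD2], intro allI impI)
    fix a assume "T a = 0"
    then have "d * norm a \<le> 0" using Tlow[of a] by simp
    then show "a = 0" using d by (simp add: mult_le_0_iff)
  qed
  have "complete (range T)"
    by (rule complete_isometric_image[OF d subspace_UNIV T _ complete_ell1]) (use Tlow in auto)
  then have "closed (range T)" by (rule complete_imp_closed)
  moreover have "subspace (range T)" using lin subspace_UNIV by (rule linear_subspace_image)
  moreover have "homeomorphism UNIV (range T) T (inv T)"
  proof (rule homeomorphismI)
    show "continuous_on UNIV T" using T by (rule linear_continuous_on)
    have lip: "dist (inv T y) (inv T z) \<le> 1 / d * dist y z" if yz: "y \<in> range T" "z \<in> range T" for y z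
    proof -
      obtain a b where ab: "y = T a" "z = T b" using yz by blast
      have "d * norm (a - b) \<le> norm (T a - T b)"
        using Tlow[of "a - b"] by (simp add: linear_diff[OF lin])
      then show ?thesis unfolding ab using inj d by (simp add: dist_norm field_simps)
    qed
    have "(1 / d)-lipschitz_on (range T) (inv T)"
      using lip d by (intro lipschitz_onI) auto
    then show "continuous_on (range T) (inv T)" by (rule lipschitz_on_continuous_on)
  qed (use inj in \<open>auto simp: f_inv_into_f\<close>)
  ultimately show ?thesis unfolding contains_ell1_def using lin by blast
qed

corollary weakly_Cauchy_subsequence:
  fixes x :: "nat \<Rightarrow> 'a::banach"
  assumes "\<not> contains_ell1 TYPE('a)" and bd: "\<And>n. norm (x n) \<le> B"
  obtains r where "strict_mono (r :: nat \<Rightarrow> nat)" "\<And>f :: 'a \<Rightarrow>\<^sub>L real. convergent (\<lambda>n. f (x (r n)))"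
proof (rule rosenthal_dichotomy[of x B])
  fix r :: "nat \<Rightarrow> nat" and d :: real
  assume "d > 0" "\<And>c k. d * (\<Sum>i<k::nat. \<bar>c i\<bar>) \<le> norm (\<Sum>i<k. c i *\<^sub>R x (r i))"
  then have "contains_ell1 TYPE('a)" by (intro contains_ell1I[of "\<lambda>n. x (r n)" B d]) (use bd in auto)
  with assms(1) show thesis by blast
qed (use bd that in auto)

section \<open>Weakly compact sets\<close>

lemma continuous_map_weak_topologyI:
  assumes "\<And>f :: 'a::real_normed_vector \<Rightarrow>\<^sub>L real. continuous_map X euclideanreal (\<lambda>x. f (g x))"
  shows "continuous_map X weak_topology g"
  unfolding weak_topology_def
proof (rule continuous_on_generated_topo)
  fix U :: "'a set"
  assume "U \<in> {blinfun_apply f -` V | (f :: 'a \<Rightarrow>\<^sub>L real) V. open V}"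
  then obtain f :: "'a \<Rightarrow>\<^sub>L real" and V where U: "U = blinfun_apply f -` V" "open V" by blast
  have "openin X {x \<in> topspace X. f (g x) \<in> V}"
    using assms U(2) by (intro openin_continuous_map_preimage) auto
  moreover have "g -` U \<inter> topspace X = {x \<in> topspace X. f (g x) \<in> V}" unfolding U by auto
  ultimately show "openin X (g -` U \<inter> topspace X)" by simp
next
  show "g ` topspace X \<subseteq> \<Union> {blinfun_apply f -` V | (f :: 'a \<Rightarrow>\<^sub>L real) V. open V}"
    using topspace_weak_topology unfolding weak_topology_def topology_generated_by_topspace by auto
qed

lemma openin_weak_topology:
  fixes f :: "'a::real_normed_vector \<Rightarrow>\<^sub>L real"
  assumes "open V" shows "openin weak_topology (blinfun_apply f -` V)"
  unfolding weak_topology_def using assms by (intro topology_generated_by_Basis) auto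

lemma continuous_map_weak_topology_blinfun:
  "continuous_map weak_topology euclideanreal (blinfun_apply (f :: 'a::real_normed_vector \<Rightarrow>\<^sub>L real))"
  unfolding continuous_map_def using openin_weak_topology[of _ f] by (auto simp: vimage_def)

text \<open>Otherwise each point of \<open>K\<close> has a weak neighbourhood that almost all
  \<open>x n\<close> avoid, and finitely many of these neighbourhoods cover
  \<open>K\<close>.\<close>

lemma weakly_compact_ultra_limit:
  fixes x :: "nat \<Rightarrow> 'a::real_normed_vector"
  assumes K: "compactin weak_topology K" and x: "\<And>n. x n \<in> K"
  obtains y where "y \<in> K" "\<And>f :: 'a \<Rightarrow>\<^sub>L real. ((\<lambda>n. f (x n)) \<longlongrightarrow> f y) nat_ultra"
proof (rule ccontr)
  note choose = that
  assume no: "\<not> thesis"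
  have "\<exists>V. openin weak_topology V \<and> y \<in> V \<and> (\<forall>\<^sub>F n in nat_ultra. x n \<notin> V)" if y: "y \<in> K" for y
  proof -
    have "\<exists>f :: 'a \<Rightarrow>\<^sub>L real. \<not> ((\<lambda>n. f (x n)) \<longlongrightarrow> f y) nat_ultra"
      using no choose[OF y] by blast
    then obtain f :: "'a \<Rightarrow>\<^sub>L real" and S where S: "open S" "f y \<in> S" "\<not> (\<forall>\<^sub>F n in nat_ultra. f (x n) \<in> S)"
      unfolding tendsto_def by auto
    then show ?thesis
      using openin_weak_topology[OF S(1), of f]
      by (intro exI[of _ "blinfun_apply f -` S"]) (auto simp: eventually_not_nat_ultra)
  qed
  then obtain V where V: "\<And>y. y \<in> K \<Longrightarrow> openin weak_topology (V y) \<and> y \<in> V y \<and> (\<forall>\<^sub>F n in nat_ultra. x n \<notin> V y)"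
    by metis
  have "\<exists>\<F>. finite \<F> \<and> \<F> \<subseteq> V ` K \<and> K \<subseteq> \<Union>\<F>"
  proof (rule compactinD[OF K])
    show "openin weak_topology U" if "U \<in> V ` K" for U using that V by auto
    show "K \<subseteq> \<Union> (V ` K)" using V by auto
  qed
  then obtain F where F: "finite F" "F \<subseteq> K" "K \<subseteq> \<Union> (V ` F)"
    by (metis finite_subset_image)
  have "\<forall>\<^sub>F n in nat_ultra. \<forall>y\<in>F. x n \<notin> V y"
    using F V by (intro eventually_ball_finite) auto
  then have "\<forall>\<^sub>F n in nat_ultra. False"
    by eventually_elim (use F x in blast)
  then show False by simp
qed

text \<open>Uniform boundedness of the evaluations at points of \<open>K\<close>, by Baire category
  in the dual, which is complete. The bound is stated on functionals, the form in which the Mackey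
  seminorms are compared with the norm.\<close>

lemma weakly_compact_bounded:
  fixes K :: "'a::real_normed_vector set"
  assumes K: "compactin weak_topology K"
  obtains C where "C \<ge> 0" "\<And>x f. x \<in> K \<Longrightarrow> \<bar>blinfun_apply f x\<bar> \<le> C * norm (f :: 'a \<Rightarrow>\<^sub>L real)"
proof -
  define E where "E n = {f :: 'a \<Rightarrow>\<^sub>L real. \<forall>x\<in>K. \<bar>blinfun_apply f x\<bar> \<le> real n}" for n :: nat
  have cl: "closed (E n)" for n
  proof -
    have "E n = (\<Inter>x\<in>K. {f. \<bar>blinfun_apply f x\<bar> \<le> real n})" unfolding E_def by auto
    then show ?thesis by (auto intro!: closed_INT closed_Collect_le continuous_intros)
  qed
  have "f \<in> (\<Union>n. E n)" for f :: "'a \<Rightarrow>\<^sub>L real"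
  proof -
    have "compact (blinfun_apply f ` K)"
      using image_compactin[OF K continuous_map_weak_topology_blinfun[of f]] by simp
    then have "bounded (blinfun_apply f ` K)" by (rule compact_imp_bounded)
    then obtain B where B: "\<And>x. x \<in> K \<Longrightarrow> \<bar>f x\<bar> \<le> B"
      unfolding bounded_iff by auto
    obtain n :: nat where "B \<le> n" using real_arch_simple by blast
    then have "f \<in> E n" using B unfolding E_def by force
    then show ?thesis by blast
  qed
  then have "\<Union> (range E) = UNIV" by blast
  then have "euclidean interior_of \<Union> (range E) \<noteq> {}" by simp
  then have "\<exists>n. interior (E n) \<noteq> {}"
    using Baire_category_alt[of "euclidean :: ('a \<Rightarrow>\<^sub>L real) topology" "range E"] cl completely_metrizable_space_euclidean
    by auto
  then obtain n f0 where "f0 \<in> interior (E n)" by blast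
  then obtain r where r: "r > 0" "cball f0 r \<subseteq> E n"
    by (meson mem_interior_cball)
  show ?thesis
  proof (rule that[of "2 * real n / r"])
    fix x and f :: "'a \<Rightarrow>\<^sub>L real" assume x: "x \<in> K"
    show "\<bar>f x\<bar> \<le> 2 * real n / r * norm f"
    proof (cases "f = 0")
      case False
      \<comment> \<open>Both \<open>f0\<close> and \<open>?g\<close> lie in the ball inside
        \<open>E n\<close>, so their difference, a multiple of \<open>f\<close> of norm
        \<open>r\<close>, is at most \<open>2 * n\<close> on \<open>K\<close>.\<close>
      let ?g = "f0 + (r / norm f) *\<^sub>R f"
      have "?g \<in> E n" "f0 \<in> E n" using r False by (auto simp: dist_norm intro!: subsetD[OF r(2)])
      then have "\<bar>f0 x + r / norm f * f x\<bar> \<le> n" "\<bar>f0 x\<bar> \<le> n"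
        using x unfolding E_def by (auto simp: blinfun.add_left blinfun.scaleR_left)
      moreover have "\<bar>b\<bar> \<le> 2 * c" if "\<bar>a + b\<bar> \<le> c" "\<bar>a\<bar> \<le> c" for a b c :: real
        using that by linarith
      ultimately have "\<bar>r / norm f * f x\<bar> \<le> 2 * real n" by blast
      then show ?thesis using r(1) False by (simp add: abs_mult field_simps)
    qed simp
  qed (use r in simp)
qed

section \<open>Absolutely convex hulls of weakly null sequences\<close>

text \<open>Coefficients are plain functions with bounded partial sums rather than elements of
  \<open>ell1\<close>: this ball is closed in a product of intervals, so Tychonoff's theorem makes
  it compact.\<close>

definition ell1_hull :: "(nat \<Rightarrow> 'a::real_normed_vector) \<Rightarrow> 'a set" where
  "ell1_hull y = (\<lambda>a. \<Sum>n. a n *\<^sub>R y n) ` {a. \<forall>n. (\<Sum>i<n. \<bar>a i\<bar>) \<le> 1}"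

lemma ell1_ball_summable:
  fixes a :: "nat \<Rightarrow> real"
  assumes "\<forall>n. (\<Sum>i<n. \<bar>a i\<bar>) \<le> 1"
  shows "summable (\<lambda>n. \<bar>a n\<bar>)" "(\<Sum>n. \<bar>a n\<bar>) \<le> 1" "\<bar>a i\<bar> \<le> 1"
proof -
  show s: "summable (\<lambda>n. \<bar>a n\<bar>)"
    using assms by (intro bounded_imp_summable[of _ 1]) (simp_all flip: lessThan_Suc_atMost del: sum.lessThan_Suc)
  show "(\<Sum>n. \<bar>a n\<bar>) \<le> 1"
    using s assms by (intro suminf_le_const) auto
  have "\<bar>a i\<bar> \<le> (\<Sum>i<Suc i. \<bar>a i\<bar>)"
    by (rule member_le_sum) auto
  also have "\<dots> \<le> 1" using assms by blast
  finally show "\<bar>a i\<bar> \<le> 1" .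
qed

lemma compact_ell1_ball: "compact {a :: nat \<Rightarrow> real. \<forall>n. (\<Sum>i<n. \<bar>a i\<bar>) \<le> 1}"
proof -
  have "compactin (product_topology (\<lambda>i. euclideanreal) UNIV) (PiE UNIV (\<lambda>i::nat. {-1..1::real}))"
    by (subst compactin_PiE) auto
  then have box: "compact (PiE UNIV (\<lambda>i::nat. {-1..1::real}))"
    unfolding euclidean_product_topology by simp
  have cl: "closed {a :: nat \<Rightarrow> real. \<forall>n. (\<Sum>i<n. \<bar>a i\<bar>) \<le> 1}"
    by (intro closed_Collect_all closed_Collect_le continuous_on_sum continuous_on_rabs
        continuous_on_product_coordinates continuous_on_const)
  have sub: "{a :: nat \<Rightarrow> real. \<forall>n. (\<Sum>i<n. \<bar>a i\<bar>) \<le> 1} \<subseteq> PiE UNIV (\<lambda>i::nat. {-1..1::real})"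
  proof
    fix a :: "nat \<Rightarrow> real" assume "a \<in> {a. \<forall>n. (\<Sum>i<n. \<bar>a i\<bar>) \<le> 1}"
    then have "\<bar>a i\<bar> \<le> 1" for i by (intro ell1_ball_summable(3)) auto
    then have "a i \<in> {-1..1}" for i by (simp add: abs_le_iff minus_le_iff)
    then show "a \<in> PiE UNIV (\<lambda>i::nat. {-1..1::real})" by auto
  qed
  have "compact B" if "compact A" "closed B" "B \<subseteq> A" for A B :: "(nat \<Rightarrow> real) set"
    using compact_Int_closed[OF that(1,2)] that(3) by (simp add: Int_absorb1)
  from this[OF box cl sub] show ?thesis .
qed

lemma blinfun_suminf:
  fixes y :: "nat \<Rightarrow> 'a::banach" and f :: "'a \<Rightarrow>\<^sub>L real"
  assumes "\<And>n. norm (y n) \<le> B" "\<forall>n. (\<Sum>i<n. \<bar>a i\<bar>) \<le> 1"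
  shows "f (\<Sum>n. a n *\<^sub>R y n) = (\<Sum>n. a n * f (y n))"
  using bounded_linear.suminf[OF blinfun.bounded_linear_right
      summable_scaleR_bounded(1)[OF assms(1) ell1_ball_summable(1)[OF assms(2)]], of f]
  by (simp add: blinfun.scaleR_right)

lemma blinfun_eq_on_ell1_hull:
  fixes y :: "nat \<Rightarrow> 'a::banach" and f g :: "'a \<Rightarrow>\<^sub>L real"
  assumes "\<And>n. norm (y n) \<le> B" "\<And>n. f (y n) = g (y n)" "x \<in> ell1_hull y"
  shows "f x = g x"
  using assms(2,3) unfolding ell1_hull_def by (auto simp: blinfun_suminf[OF assms(1)])

lemma mem_ell1_hull: "y k \<in> ell1_hull y"
proof -
  let ?a = "\<lambda>n. if n = k then 1 else 0 :: real"
  have "(\<lambda>n. ?a n *\<^sub>R y n) = (\<lambda>n. if n = k then y n else 0)" by auto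
  then have "(\<Sum>n. ?a n *\<^sub>R y n) = y k"
    using sums_unique[OF sums_single[of k y]] by simp
  moreover have "(\<Sum>i<n. \<bar>?a i\<bar>) \<le> 1" for n
    by (simp add: if_distrib cong: if_cong)
  ultimately show ?thesis
    unfolding ell1_hull_def by (intro image_eqI[of _ _ ?a]) auto
qed

lemma absolutely_convex_ell1_hull:
  fixes y :: "nat \<Rightarrow> 'a::banach"
  assumes "\<And>n. norm (y n) \<le> B"
  shows "absolutely_convex (ell1_hull y)"
  unfolding absolutely_convex_def
proof (intro ballI allI impI)
  fix u v and b c :: real
  assume "u \<in> ell1_hull y" "v \<in> ell1_hull y" and bc: "\<bar>b\<bar> + \<bar>c\<bar> \<le> 1"
  then obtain s t where s: "u = (\<Sum>n. s n *\<^sub>R y n)" "\<forall>n. (\<Sum>i<n. \<bar>s i\<bar>) \<le> 1"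
    and t: "v = (\<Sum>n. t n *\<^sub>R y n)" "\<forall>n. (\<Sum>i<n. \<bar>t i\<bar>) \<le> 1"
    unfolding ell1_hull_def by auto
  note su = summable_scaleR_bounded(1)[OF assms ell1_ball_summable(1)[OF s(2)]]
  note tu = summable_scaleR_bounded(1)[OF assms ell1_ball_summable(1)[OF t(2)]]
  have "b *\<^sub>R u + c *\<^sub>R v = (\<Sum>n. (b * s n + c * t n) *\<^sub>R y n)"
    unfolding s t
    using suminf_add[OF summable_scaleR_right[OF su, of b] summable_scaleR_right[OF tu, of c]]
    by (simp add: suminf_scaleR_right[OF su] suminf_scaleR_right[OF tu] scaleR_add_left)
  moreover have "(\<Sum>i<n. \<bar>b * s i + c * t i\<bar>) \<le> 1" for n
  proof -
    have "(\<Sum>i<n. \<bar>b * s i + c * t i\<bar>) \<le> (\<Sum>i<n. \<bar>b\<bar> * \<bar>s i\<bar> + \<bar>c\<bar> * \<bar>t i\<bar>)"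
      by (rule sum_mono) (metis abs_mult abs_triangle_ineq)
    also have "\<dots> = \<bar>b\<bar> * (\<Sum>i<n. \<bar>s i\<bar>) + \<bar>c\<bar> * (\<Sum>i<n. \<bar>t i\<bar>)"
      by (simp add: sum.distrib sum_distrib_left)
    also have "\<dots> \<le> \<bar>b\<bar> * 1 + \<bar>c\<bar> * 1"
      using s(2) t(2) by (intro add_mono mult_left_mono) auto
    finally show ?thesis using bc by simp
  qed
  ultimately show "b *\<^sub>R u + c *\<^sub>R v \<in> ell1_hull y"
    unfolding ell1_hull_def by (intro image_eqI[of _ _ "\<lambda>n. b * s n + c * t n"]) auto
qed

text \<open>The hull is the image of the compact ball of \<open>\<ell>\<^sub>1 = c\<^sub>0*\<close> under a map that is weak*-to-weak
  continuous because \<open>y\<close> is weakly null.\<close>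
lemma compactin_ell1_hull:
  fixes y :: "nat \<Rightarrow> 'a::banach"
  assumes bd: "\<And>n. norm (y n) \<le> B" and null: "\<And>f :: 'a \<Rightarrow>\<^sub>L real. (\<lambda>n. f (y n)) \<longlonglongrightarrow> 0"
  shows "compactin weak_topology (ell1_hull y)"
proof -
  let ?B = "{a :: nat \<Rightarrow> real. \<forall>n. (\<Sum>i<n. \<bar>a i\<bar>) \<le> 1}"
  have cont: "continuous_on ?B (\<lambda>a. \<Sum>n. a n * f (y n))" for f :: "'a \<Rightarrow>\<^sub>L real"
  proof (rule uniform_limit_theorem)
    show "\<forall>\<^sub>F n in sequentially. continuous_on ?B (\<lambda>a. \<Sum>i<n. a i * f (y i))"
      by (intro always_eventually allI continuous_on_sum continuous_on_mult continuous_on_const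
          continuous_on_subset[OF continuous_on_product_coordinates subset_UNIV])
    show "uniform_limit ?B (\<lambda>n a. \<Sum>i<n. a i * f (y i)) (\<lambda>a. \<Sum>n. a n * f (y n)) sequentially"
    proof (rule uniform_limitI)
      fix e :: real assume e: "e > 0"
      \<comment> \<open>Weak nullity enters here: the tail of the series from \<open>n\<close> on is
        at most the supremum of \<open>\<bar>f (y i)\<bar>\<close> over \<open>i \<ge> n\<close>,
        uniformly over the ball of coefficients.\<close>
      then obtain N where N: "\<And>n. n \<ge> N \<Longrightarrow> \<bar>f (y n)\<bar> \<le> e / 2"
        using LIMSEQ_D[OF null[of f], of "e / 2"] by (auto intro: less_imp_le)
      have "dist (\<Sum>i<n. a i * f (y i)) (\<Sum>n. a n * f (y n)) < e" if n: "n \<ge> N" and a: "a \<in> ?B" for n a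
      proof -
        have a1: "summable (\<lambda>n. \<bar>a n\<bar>)" "(\<Sum>n. \<bar>a n\<bar>) \<le> 1"
          using a ell1_ball_summable[of a] by auto
        have s: "summable (\<lambda>n. a n * f (y n))"
          using bounded_linear.summable[OF blinfun.bounded_linear_right
              summable_scaleR_bounded(1)[OF bd a1(1)], of f] by (simp add: blinfun.scaleR_right)
        have tail: "summable (\<lambda>i. \<bar>a (i + n)\<bar>)" using a1(1) by (subst summable_iff_shift)
        have "(\<Sum>i. a i * f (y i)) - (\<Sum>i<n. a i * f (y i)) = (\<Sum>i. a (i + n) *\<^sub>R f (y (i + n)))"
          using suminf_split_initial_segment[OF s, of n] by simp
        also have "norm \<dots> \<le> (\<Sum>i. \<bar>a (i + n)\<bar>) * (e / 2)"
          by (rule summable_scaleR_bounded(2)) (use N n tail in auto)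
        also have "\<dots> \<le> 1 * (e / 2)"
        proof (rule mult_right_mono)
          have "(\<Sum>i. \<bar>a (i + n)\<bar>) \<le> (\<Sum>i. \<bar>a i\<bar>)"
            using suminf_split_initial_segment[OF a1(1), of n] by (simp add: sum_nonneg)
          with a1(2) show "(\<Sum>i. \<bar>a (i + n)\<bar>) \<le> 1" by simp
        qed (use e in simp)
        finally show ?thesis using e by (simp add: dist_real_def abs_minus_commute)
      qed
      then show "\<forall>\<^sub>F n in sequentially. \<forall>a\<in>?B. dist (\<Sum>i<n. a i * f (y i)) (\<Sum>n. a n * f (y n)) < e"
        unfolding eventually_sequentially by blast
    qed
  qed simp
  have "continuous_map (top_of_set ?B) weak_topology (\<lambda>a. \<Sum>n. a n *\<^sub>R y n)"
  proof (rule continuous_map_weak_topologyI)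
    fix f :: "'a \<Rightarrow>\<^sub>L real"
    have "continuous_on ?B (\<lambda>a. f (\<Sum>n. a n *\<^sub>R y n))"
      by (rule continuous_on_cong[THEN iffD2, OF refl _ cont[of f]]) (simp add: blinfun_suminf[OF bd])
    then show "continuous_map (top_of_set ?B) euclideanreal (\<lambda>a. f (\<Sum>n. a n *\<^sub>R y n))"
      by simp
  qed
  moreover have "compactin (top_of_set ?B) ?B"
    using compact_ell1_ball by (simp add: compactin_subtopology)
  ultimately show ?thesis
    unfolding ell1_hull_def by (rule image_compactin[rotated])
qed

section \<open>Mackey convergence and norm convergence\<close>

lemma tendsto_zero_eventually_less:
  fixes f :: "nat \<Rightarrow> real"
  assumes "f \<longlonglongrightarrow> 0" "e > 0"
  shows "\<forall>\<^sub>F n in sequentially. \<bar>f n\<bar> < e"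
  using tendstoD[OF assms] by (simp add: dist_real_def)

text \<open>The norm need not be attained, whence the loss of a factor 2.\<close>

lemma norm_ge_witness:
  fixes g :: "'a::real_normed_vector \<Rightarrow>\<^sub>L real"
  assumes "norm g \<ge> e" "e > 0"
  obtains x where "norm x \<le> 1" "\<bar>g x\<bar> \<ge> e / 2"
proof -
  have "\<exists>x. \<not> norm (g x) \<le> e / 2 * norm x"
  proof (rule ccontr)
    assume "\<nexists>x. \<not> norm (g x) \<le> e / 2 * norm x"
    then have "norm g \<le> e / 2" using assms(2) by (intro norm_blinfun_bound) auto
    with assms show False by simp
  qed
  then obtain x where x: "\<bar>g x\<bar> > e / 2 * norm x" unfolding not_le real_norm_def by blast
  then have "x \<noteq> 0" by auto
  show thesis
  proof (rule that[of "(1 / norm x) *\<^sub>R x"])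
    show "norm ((1 / norm x) *\<^sub>R x) \<le> 1" using \<open>x \<noteq> 0\<close> by simp
    show "\<bar>g ((1 / norm x) *\<^sub>R x)\<bar> \<ge> e / 2"
      using x \<open>x \<noteq> 0\<close> by (simp add: blinfun.scaleR_right field_simps)
  qed
qed

text \<open>A gliding hump: along a weakly Cauchy subsequence of \<open>z\<close> the consecutive
  differences \<open>y\<close> are weakly null, so \<open>h k\<close> is eventually small on their
  hull. If the indices are sparse, \<open>h\<close> is also small at the preceding term, so it is
  small at the current one. Only differences of terms of \<open>z\<close> occur in
  \<open>unif\<close>, since in the countably compact case uniform smallness is available only on
  hulls of such vectors.\<close>

lemma uniformly_null_on_ell1_hulls_imp_null:
  fixes z :: "nat \<Rightarrow> 'a::banach" and h :: "nat \<Rightarrow> 'a \<Rightarrow>\<^sub>L real"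
  assumes ell1: "\<not> contains_ell1 TYPE('a)" and bd: "\<And>n. norm (z n) \<le> B"
    and pt: "\<And>j. (\<lambda>k. h k (z j)) \<longlonglongrightarrow> 0"
    and unif: "\<And>y e. \<lbrakk>\<And>n. norm (y n) \<le> 2 * B; \<And>f :: 'a \<Rightarrow>\<^sub>L real. (\<lambda>n. f (y n)) \<longlonglongrightarrow> 0;
        \<And>n. \<exists>i j. y n = z i - z j; e > 0\<rbrakk>
      \<Longrightarrow> \<forall>\<^sub>F k in sequentially. \<forall>x\<in>ell1_hull y. \<bar>h k x\<bar> < e"
  shows "(\<lambda>k. h k (z k)) \<longlonglongrightarrow> 0"
proof (rule ccontr)
  assume "\<not> ?thesis"
  then obtain e r where e: "e > 0" "strict_mono (r :: nat \<Rightarrow> nat)" "\<And>k. norm (h (r k) (z (r k))) \<ge> e"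
    by (rule not_tendsto_zero_subseq) blast
  obtain q where q: "strict_mono (q :: nat \<Rightarrow> nat)" "\<And>f :: 'a \<Rightarrow>\<^sub>L real. convergent (\<lambda>n. f (z (r (q n))))"
    using weakly_Cauchy_subsequence[OF ell1, of "\<lambda>n. z (r n)" B] bd by auto
  define R where "R = r \<circ> q"
  have R: "strict_mono R" unfolding R_def using e(2) q(1) by (rule strict_mono_o)
  \<comment> \<open>By \<open>pt\<close>, an index can be postponed until its functional is below
    \<open>e / 2\<close> at the vector chosen before; the other \<open>e / 2\<close> is spent on the
    difference.\<close>
  have "\<exists>p. \<forall>n::nat. True \<and> (p n < p (Suc n) \<and> \<bar>h (R (p (Suc n))) (z (R (p n)))\<bar> < e / 2)"
  proof (rule dependent_nat_choice)
    fix a n :: nat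
    have "(\<lambda>k. h (R k) (z (R a))) \<longlonglongrightarrow> 0"
      using LIMSEQ_subseq_LIMSEQ[OF pt R] by (simp add: o_def)
    then have "\<forall>\<^sub>F k in sequentially. \<bar>h (R k) (z (R a))\<bar> < e / 2"
      by (rule tendsto_zero_eventually_less) (use e(1) in simp)
    then have "\<forall>\<^sub>F k in sequentially. a < k \<and> \<bar>h (R k) (z (R a))\<bar> < e / 2"
      using eventually_gt_at_top[of a] by eventually_elim auto
    then show "\<exists>b. True \<and> (a < b \<and> \<bar>h (R b) (z (R a))\<bar> < e / 2)"
      using eventually_happens[of _ sequentially] by fastforce
  qed auto
  then obtain p where p: "\<And>n::nat. p n < p (Suc n)" "\<And>n. \<bar>h (R (p (Suc n))) (z (R (p n)))\<bar> < e / 2"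
    by auto
  have pm: "strict_mono p" using p(1) by (simp add: strict_mono_Suc_iff)
  define y where "y n = z (R (p (Suc n))) - z (R (p n))" for n
  have null: "(\<lambda>n. f (y n)) \<longlonglongrightarrow> 0" for f :: "'a \<Rightarrow>\<^sub>L real"
  proof -
    obtain l where "(\<lambda>n. f (z (R n))) \<longlonglongrightarrow> l"
      using q(2)[of f] unfolding convergent_def R_def by auto
    then have l: "(\<lambda>n. f (z (R (p n)))) \<longlonglongrightarrow> l"
      using LIMSEQ_subseq_LIMSEQ[OF _ pm] by (fastforce simp: o_def)
    have "(\<lambda>n. f (z (R (p (Suc n)))) - f (z (R (p n)))) \<longlonglongrightarrow> l - l"
      by (intro tendsto_diff l LIMSEQ_Suc)
    then show ?thesis unfolding y_def by (simp add: blinfun.diff_right)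
  qed
  have "norm (y n) \<le> 2 * B" for n
    unfolding y_def using norm_triangle_ineq4[of "z (R (p (Suc n)))" "z (R (p n))"] bd[of "R (p (Suc n))"] bd[of "R (p n)"] by simp
  then have "\<forall>\<^sub>F k in sequentially. \<forall>x\<in>ell1_hull y. \<bar>h k x\<bar> < e / 2"
    using null e(1) by (intro unif) (auto simp: y_def)
  moreover have "strict_mono (\<lambda>k. R (p (Suc k)))"
    using R pm unfolding strict_mono_def by auto
  ultimately have "\<forall>\<^sub>F k in sequentially. \<forall>x\<in>ell1_hull y. \<bar>h (R (p (Suc k))) x\<bar> < e / 2"
    by (rule eventually_subseq[rotated])
  then obtain k where "\<forall>x\<in>ell1_hull y. \<bar>h (R (p (Suc k))) x\<bar> < e / 2"
    using eventually_happens[of _ sequentially] by fastforce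
  then have "\<bar>h (R (p (Suc k))) (y k)\<bar> < e / 2" using mem_ell1_hull by blast
  then have "\<bar>h (R (p (Suc k))) (z (R (p (Suc k)))) - h (R (p (Suc k))) (z (R (p k)))\<bar> < e / 2"
    unfolding y_def by (simp add: blinfun.diff_right)
  moreover have "\<bar>a\<bar> < e" if "\<bar>a - b\<bar> < e / 2" "\<bar>b\<bar> < e / 2" for a b :: real
    using that by linarith
  ultimately have "\<bar>h (R (p (Suc k))) (z (R (p (Suc k))))\<bar> < e"
    using p(2)[of k] by blast
  with e(3)[of "q (p (Suc k))"] show False by (simp add: R_def)
qed

lemma ell1_hull_mackey:
  fixes y :: "nat \<Rightarrow> 'a::banach"
  assumes "\<And>n. norm (y n) \<le> B" and "\<And>f :: 'a \<Rightarrow>\<^sub>L real. (\<lambda>n. f (y n)) \<longlonglongrightarrow> 0"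
  shows "compactin weak_topology (ell1_hull y) \<and> absolutely_convex (ell1_hull y)"
  using compactin_ell1_hull[OF assms] absolutely_convex_ell1_hull[of y B, OF assms(1)] by blast

lemma point_in_mackey_set:
  fixes x :: "'a::banach"
  obtains K where "x \<in> K" "compactin weak_topology K" "absolutely_convex K"
proof -
  \<comment> \<open>The hull of \<open>x, 0, 0, ...\<close> is the segment from \<open>-x\<close> to
    \<open>x\<close>.\<close>
  let ?y = "\<lambda>n::nat. if n = 0 then x else 0"
  have "(\<lambda>n. f (?y n)) \<longlonglongrightarrow> 0" for f :: "'a \<Rightarrow>\<^sub>L real"
    by (rule tendsto_eventually) (auto simp: eventually_sequentially intro!: exI[of _ 1])
  then have "compactin weak_topology (ell1_hull ?y) \<and> absolutely_convex (ell1_hull ?y)"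
    by (intro ell1_hull_mackey[of _ "norm x"]) auto
  moreover have "x \<in> ell1_hull ?y" using mem_ell1_hull[of ?y 0] by simp
  ultimately show ?thesis using that by blast
qed

lemma limitin_mackey_pointwise:
  fixes f :: "nat \<Rightarrow> 'a::banach \<Rightarrow>\<^sub>L real"
  assumes "limitin mackey_topology f l sequentially"
  shows "(\<lambda>n. f n x) \<longlonglongrightarrow> l x"
proof -
  obtain K where "x \<in> K" "compactin weak_topology K" "absolutely_convex K"
    by (rule point_in_mackey_set)
  with assms show ?thesis
    by (metis limitin_mackey_topology tendsto_uniform_limitI)
qed

theorem no_ell1_imp_sequentially_reflexive:
  assumes ell1: "\<not> contains_ell1 TYPE('a::banach)"
  shows "sequentially_reflexive TYPE('a)"
  unfolding sequentially_reflexive_def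
proof (intro allI impI)
  fix f :: "nat \<Rightarrow> 'a \<Rightarrow>\<^sub>L real" assume "\<exists>l. limitin mackey_topology f l sequentially"
  then obtain l where l: "limitin mackey_topology f l sequentially" by blast
  have "(\<lambda>n. f n - l) \<longlonglongrightarrow> 0"
  proof (rule ccontr)
    assume "\<not> ?thesis"
    then obtain e r where e: "e > 0" "strict_mono (r :: nat \<Rightarrow> nat)" "\<And>k. norm (f (r k) - l) \<ge> e"
      by (rule not_tendsto_zero_subseq) blast
    have "\<exists>x. norm x \<le> 1 \<and> \<bar>(f (r k) - l) x\<bar> \<ge> e / 2" for k
      using norm_ge_witness[OF e(3,1), of k] by metis
    then obtain z where z: "\<And>k. norm (z k) \<le> 1" "\<And>k. \<bar>(f (r k) - l) (z k)\<bar> \<ge> e / 2" by metis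
    have "(\<lambda>k. (f (r k) - l) (z k)) \<longlonglongrightarrow> 0"
    proof (rule uniformly_null_on_ell1_hulls_imp_null[OF ell1, where B = 1])
      show "(\<lambda>k. (f (r k) - l) (z j)) \<longlonglongrightarrow> 0" for j
        using LIMSEQ_subseq_LIMSEQ[OF limitin_mackey_pointwise[OF l, of "z j"] e(2)]
        by (simp add: blinfun.diff_left o_def LIM_zero)
      fix y :: "nat \<Rightarrow> 'a" and d :: real
      assume y: "\<And>n. norm (y n) \<le> 2 * 1" "\<And>g :: 'a \<Rightarrow>\<^sub>L real. (\<lambda>n. g (y n)) \<longlonglongrightarrow> 0" and "d > 0"
      have "uniform_limit (ell1_hull y) (\<lambda>n. blinfun_apply (f n)) (blinfun_apply l) sequentially"
        using l ell1_hull_mackey[OF y] by (simp add: limitin_mackey_topology)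
      then have "\<forall>\<^sub>F k in sequentially. \<forall>x\<in>ell1_hull y. dist (f k x) (l x) < d"
        using \<open>d > 0\<close> by (rule uniform_limitD)
      from eventually_subseq[OF e(2) this]
      show "\<forall>\<^sub>F k in sequentially. \<forall>x\<in>ell1_hull y. \<bar>(f (r k) - l) x\<bar> < d"
        by (simp add: dist_real_def blinfun.diff_left)
    qed (use z in auto)
    then have "\<forall>\<^sub>F k in sequentially. \<bar>(f (r k) - l) (z k)\<bar> < e / 2"
      by (rule tendsto_zero_eventually_less) (use e(1) in simp)
    then show False using z(2) by (simp add: not_less[symmetric])
  qed
  then show "convergent f"
    unfolding convergent_def using LIM_zero_cancel by blast
qed

text \<open>Countably many vectors \<open>w m n\<close> almost norm the differences
  \<open>f m - f n\<close>. Scaled to a null sequence \<open>u\<close>, they span a single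
  admissible hull, on which a subsequence \<open>f (r k)\<close> approaches \<open>g\<close>
  uniformly. Every cluster functional of a further subsequence then equals \<open>g\<close> at all
  \<open>w m n\<close>, which makes \<open>h k = f (r k) - g\<close> uniformly null on hulls of
  weakly null differences of the \<open>w m n\<close>. The gliding hump contradicts the
  separation.\<close>

lemma no_separated_mackey_clustering_sequence:
  fixes f :: "nat \<Rightarrow> 'a::banach \<Rightarrow>\<^sub>L real"
  assumes ell1: "\<not> contains_ell1 TYPE('a)"
    and cluster: "\<And>r. strict_mono (r :: nat \<Rightarrow> nat) \<Longrightarrow> \<exists>g :: 'a \<Rightarrow>\<^sub>L real. \<forall>K e.
      compactin weak_topology K \<and> absolutely_convex K \<and> e > 0 \<longrightarrow>
      (\<exists>\<^sub>F n in sequentially. \<forall>x\<in>K. \<bar>f (r n) x - g x\<bar> < e)"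
    and sep: "\<And>m n. m < n \<Longrightarrow> norm (f m - f n) \<ge> e" and e: "e > 0"
  shows False
proof -
  have "\<exists>x. norm x \<le> 1 \<and> \<bar>(f m - f n) x\<bar> \<ge> e / 2" if "m < n" for m n
    using norm_ge_witness[OF sep[OF that] e] by metis
  \<comment> \<open>The guard, with 0 as default vector, bounds \<open>w m n\<close> for all pairs,
    so that \<open>prod_decode\<close> can enumerate them without exception.\<close>
  then have "\<exists>x. norm x \<le> 1 \<and> (m < n \<longrightarrow> \<bar>(f m - f n) x\<bar> \<ge> e / 2)" for m n
    by (cases "m < n") (auto intro: exI[of _ 0])
  then obtain w where w: "\<And>m n. norm (w m n) \<le> 1" "\<And>m n. m < n \<Longrightarrow> \<bar>(f m - f n) (w m n)\<bar> \<ge> e / 2"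
    by metis
  define d where "d i = w (fst (prod_decode i)) (snd (prod_decode i))" for i
  have wd: "\<exists>i. w m n = d i" for m n
    by (rule exI[of _ "prod_encode (m, n)"]) (simp add: d_def)
  have dn: "norm (d i) \<le> 1" for i unfolding d_def by (rule w)
  \<comment> \<open>The factor forces convergence to 0 in norm, hence weakly; by linearity it can be
    undone for each single vector, though not uniformly.\<close>
  define u where "u i = (1 / real (Suc i)) *\<^sub>R d i" for i
  have un: "norm (u i) \<le> 1 / real (Suc i)" for i
    unfolding u_def using dn[of i] by (simp add: divide_right_mono)
  have u1: "norm (u i) \<le> 1" for i
    using un[of i] by (rule order_trans) simp
  have "u \<longlonglongrightarrow> 0"
    by (rule Lim_null_comparison[OF _ LIMSEQ_inverse_real_of_nat]) (use un in \<open>simp add: inverse_eq_divide\<close>)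
  then have "(\<lambda>n. f (u n)) \<longlonglongrightarrow> 0" for f :: "'a \<Rightarrow>\<^sub>L real"
    using blinfun.tendsto[OF tendsto_const, of u 0 sequentially f] by (simp add: blinfun.zero_right)
  note K = ell1_hull_mackey[OF u1 this]
  obtain g :: "'a \<Rightarrow>\<^sub>L real" where g: "\<And>K e. compactin weak_topology K \<and> absolutely_convex K \<and> e > 0 \<Longrightarrow>
      \<exists>\<^sub>F n in sequentially. \<forall>x\<in>K. \<bar>f n x - g x\<bar> < e"
    using cluster[of id] strict_mono_id by auto
  obtain r where r: "strict_mono (r :: nat \<Rightarrow> nat)" "\<And>k. \<forall>x\<in>ell1_hull u. \<bar>f (r k) x - g x\<bar> < 1 / real (Suc k)"
    using frequently_subseq[of "\<lambda>k n. \<forall>x\<in>ell1_hull u. \<bar>f n x - g x\<bar> < 1 / real (Suc k)"] g K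
    by auto
  define h where "h k = f (r k) - g" for k
  have hu: "(\<lambda>k. h k (u i)) \<longlonglongrightarrow> 0" for i
  proof (rule Lim_null_comparison[OF _ LIMSEQ_inverse_real_of_nat])
    have "norm (h k (u i)) \<le> inverse (real (Suc k))" for k
      using r(2)[of k] mem_ell1_hull[of u i] by (force simp: h_def blinfun.diff_left inverse_eq_divide)
    then show "\<forall>\<^sub>F k in sequentially. norm (h k (u i)) \<le> inverse (real (Suc k))" by simp
  qed
  have du: "d i = real (Suc i) *\<^sub>R u i" for i unfolding u_def by simp
  have hw: "(\<lambda>k. h k (w m n)) \<longlonglongrightarrow> 0" for m n
  proof -
    obtain i where i: "w m n = d i" using wd by blast
    have "(\<lambda>k. real (Suc i) * h k (u i)) \<longlonglongrightarrow> real (Suc i) * 0"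
      by (intro tendsto_mult tendsto_const hu)
    then show ?thesis unfolding i du by (simp add: blinfun.scaleR_right del: of_nat_Suc)
  qed
  \<comment> \<open>A failure would persist along a subsequence \<open>q\<close>. That subsequence
    has a cluster functional \<open>g'\<close> of its own, but \<open>g'\<close> and
    \<open>g\<close> coincide on the hull of \<open>y\<close>, so some term is uniformly close to
    \<open>g\<close> there after all.\<close>
  have unif: "\<forall>\<^sub>F k in sequentially. \<forall>x\<in>ell1_hull y. \<bar>h k x\<bar> < c"
    if y: "\<And>n. norm (y n) \<le> 2" "\<And>f :: 'a \<Rightarrow>\<^sub>L real. (\<lambda>n. f (y n)) \<longlonglongrightarrow> 0"
      "\<And>n. \<exists>i j i' j'. y n = w i j - w i' j'" and c: "c > 0" for y c
  proof (rule ccontr)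
    assume "\<not> ?thesis"
    then have "\<exists>\<^sub>F k in sequentially. \<not> (\<forall>x\<in>ell1_hull y. \<bar>h k x\<bar> < c)"
      by (simp add: not_eventually)
    then obtain q where q: "strict_mono (q :: nat \<Rightarrow> nat)" "\<And>k. \<not> (\<forall>x\<in>ell1_hull y. \<bar>h (q k) x\<bar> < c)"
      using frequently_subseq1 by blast
    have rq: "strict_mono (r \<circ> q)" using r(1) q(1) by (rule strict_mono_o)
    obtain g' :: "'a \<Rightarrow>\<^sub>L real" where g': "\<And>K e. compactin weak_topology K \<and> absolutely_convex K \<and> e > 0 \<Longrightarrow>
      \<exists>\<^sub>F n in sequentially. \<forall>x\<in>K. \<bar>f (r (q n)) x - g' x\<bar> < e"
      using cluster[OF rq] by auto
    \<comment> \<open>At \<open>u i\<close> the whole sequence \<open>f (r k)\<close> converges to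
      \<open>g\<close>, which leaves no other value for a cluster point.\<close>
    have "g' (u i) = g (u i)" for i
    proof (rule ccontr)
      assume ne: "g' (u i) \<noteq> g (u i)"
      define s where "s = \<bar>g' (u i) - g (u i)\<bar> / 2"
      have s: "s > 0" using ne by (simp add: s_def)
      have "\<exists>\<^sub>F n in sequentially. \<bar>f (r (q n)) (u i) - g' (u i)\<bar> < s"
        using g'[of "ell1_hull u" s] K s by (auto elim!: frequently_elim1 intro: mem_ell1_hull)
      moreover have "(\<lambda>k. h (q k) (u i)) \<longlonglongrightarrow> 0"
        using LIMSEQ_subseq_LIMSEQ[OF hu q(1)] by (simp add: o_def)
      then have "\<forall>\<^sub>F n in sequentially. \<bar>h (q n) (u i)\<bar> < s"
        by (rule tendsto_zero_eventually_less) (use s in simp)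
      ultimately have "\<exists>\<^sub>F n in sequentially. \<bar>f (r (q n)) (u i) - g' (u i)\<bar> < s \<and> \<bar>h (q n) (u i)\<bar> < s"
        by (rule frequently_eventually_frequently)
      then obtain n where "\<bar>f (r (q n)) (u i) - g' (u i)\<bar> < s" "\<bar>h (q n) (u i)\<bar> < s"
        by (auto dest: frequently_ex)
      then have "\<bar>f (r (q n)) (u i) - g' (u i)\<bar> < s" "\<bar>f (r (q n)) (u i) - g (u i)\<bar> < s"
        by (auto simp: h_def blinfun.diff_left)
      moreover have "\<bar>b - c\<bar> < s + s" if "\<bar>a - b\<bar> < s" "\<bar>a - c\<bar> < s" for a b c :: real
        using that by linarith
      ultimately have "\<bar>g' (u i) - g (u i)\<bar> < s + s" by blast
      then show False unfolding s_def by simp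
    qed
    then have "g' (w m n) = g (w m n)" for m n
      using wd[of m n] du by (auto simp: blinfun.scaleR_right)
    then have "g' (y n) = g (y n)" for n
      using y(3)[of n] by (auto simp: blinfun.diff_right)
    then have eq: "g' x = g x" if "x \<in> ell1_hull y" for x
      using blinfun_eq_on_ell1_hull[OF y(1) _ that] by blast
    have "\<exists>\<^sub>F n in sequentially. \<forall>x\<in>ell1_hull y. \<bar>f (r (q n)) x - g' x\<bar> < c"
      using ell1_hull_mackey[OF y(1,2)] c by (intro g') auto
    then obtain n where "\<forall>x\<in>ell1_hull y. \<bar>f (r (q n)) x - g' x\<bar> < c"
      by (auto dest: frequently_ex)
    then have "\<forall>x\<in>ell1_hull y. \<bar>h (q n) x\<bar> < c"
      using eq by (simp add: h_def blinfun.diff_left)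
    with q(2)[of n] show False by blast
  qed
  \<comment> \<open>In \<open>h k - h (Suc k)\<close> the functional \<open>g\<close> cancels,
    leaving the difference \<open>f (r k) - f (r (Suc k))\<close> that this vector almost
    norms.\<close>
  define z where "z k = w (r k) (r (Suc k))" for k
  have "(\<lambda>k. (h k - h (Suc k)) (z k)) \<longlonglongrightarrow> 0"
  proof (rule uniformly_null_on_ell1_hulls_imp_null[OF ell1, where B = 1])
    show "norm (z n) \<le> 1" for n unfolding z_def by (rule w)
    show "(\<lambda>k. (h k - h (Suc k)) (z j)) \<longlonglongrightarrow> 0" for j
      using tendsto_diff[OF hw LIMSEQ_Suc[OF hw]] unfolding z_def by (auto simp: blinfun.diff_left)
    fix y :: "nat \<Rightarrow> 'a" and c :: real
    assume y: "\<And>n. norm (y n) \<le> 2 * 1" "\<And>g :: 'a \<Rightarrow>\<^sub>L real. (\<lambda>n. g (y n)) \<longlonglongrightarrow> 0"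
      "\<And>n. \<exists>i j. y n = z i - z j" and "c > 0"
    have ev: "\<forall>\<^sub>F k in sequentially. \<forall>x\<in>ell1_hull y. \<bar>h k x\<bar> < c / 2"
    proof (rule unif)
      show "\<exists>i j i' j'. y n = w i j - w i' j'" for n
        using y(3)[of n] unfolding z_def by blast
    qed (use y \<open>c > 0\<close> in auto)
    then have "\<forall>\<^sub>F k in sequentially. \<forall>x\<in>ell1_hull y. \<bar>h (Suc k) x\<bar> < c / 2"
      by (rule eventually_sequentially_Suc[THEN iffD2])
    with ev show "\<forall>\<^sub>F k in sequentially. \<forall>x\<in>ell1_hull y. \<bar>(h k - h (Suc k)) x\<bar> < c"
    proof eventually_elim
      case (elim k)
      show ?case
      proof
        fix x assume "x \<in> ell1_hull y"
        then have "\<bar>h k x\<bar> < c / 2" "\<bar>h (Suc k) x\<bar> < c / 2" using elim by auto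
        then show "\<bar>(h k - h (Suc k)) x\<bar> < c" by (simp add: blinfun.diff_left)
      qed
    qed
  qed
  then have "\<forall>\<^sub>F k in sequentially. \<bar>(h k - h (Suc k)) (z k)\<bar> < e / 2"
    by (rule tendsto_zero_eventually_less) (use e in simp)
  then obtain k where "\<bar>(h k - h (Suc k)) (z k)\<bar> < e / 2"
    by (auto simp: eventually_sequentially)
  moreover have "\<bar>(h k - h (Suc k)) (z k)\<bar> \<ge> e / 2"
    using w(2)[of "r k" "r (Suc k)"] r(1) unfolding h_def z_def by (simp add: strict_mono_Suc_iff)
  ultimately show False by simp
qed

section \<open>The Mackey topology and compactness\<close>

lemma openin_mackey_ball:
  assumes "compactin weak_topology K" "absolutely_convex K" "e > 0"
  shows "openin mackey_topology {g. \<exists>d<e. \<forall>x\<in>K. \<bar>blinfun_apply g x - blinfun_apply f x\<bar> \<le> d}"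
  unfolding mackey_topology_def using assms by (intro topology_generated_by_Basis) blast

text \<open>Weakly compact sets are bounded, so each Mackey seminorm is dominated by a multiple of
  the dual norm.\<close>

lemma open_mackey:
  fixes U :: "('a::real_normed_vector \<Rightarrow>\<^sub>L real) set"
  assumes "openin mackey_topology U"
  shows "open U"
  using assms unfolding mackey_topology_def openin_topology_generated_by_iff
proof (induction rule: generate_topology_on.induct)
  case (Basis V)
  then obtain f :: "'a \<Rightarrow>\<^sub>L real" and K e where K: "compactin weak_topology K"
    and V: "V = {g. \<exists>d<e. \<forall>x\<in>K. \<bar>blinfun_apply g x - blinfun_apply f x\<bar> \<le> d}" by blast
  obtain C where C: "C \<ge> 0" "\<And>x g. x \<in> K \<Longrightarrow> \<bar>blinfun_apply g x\<bar> \<le> C * norm (g :: 'a \<Rightarrow>\<^sub>L real)"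
    by (rule weakly_compact_bounded[OF K]) blast
  show ?case
    unfolding open_dist
  proof
    fix g assume "g \<in> V"
    then obtain d where d: "d < e" "\<And>x. x \<in> K \<Longrightarrow> \<bar>g x - f x\<bar> \<le> d" unfolding V by blast
    \<comment> \<open>A move by less than \<open>s\<close> changes values on \<open>K\<close> by at
      most half of the slack \<open>e - d\<close>; \<open>C + 1\<close> avoids division by
      zero.\<close>
    define s where "s = (e - d) / (2 * (C + 1))"
    have s: "s > 0" using C(1) d(1) unfolding s_def by simp
    have Cs: "C * s \<le> (e - d) / 2"
    proof -
      have "C * s \<le> (C + 1) * s" using s by simp
      also have "\<dots> = (e - d) / 2" unfolding s_def using C(1) by (simp add: field_simps)
      finally show ?thesis .
    qed
    have "g' \<in> V" if g': "dist g' g < s" for g'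
    proof -
      have "\<bar>g' x - f x\<bar> \<le> (e + d) / 2" if x: "x \<in> K" for x
      proof -
        have "\<bar>(g' - g) x\<bar> \<le> C * norm (g' - g)" using C(2)[OF x] .
        also have "\<dots> \<le> C * s" using g' C(1) by (intro mult_left_mono) (auto simp: dist_norm)
        finally have "\<bar>g' x - g x\<bar> \<le> (e - d) / 2" using Cs by (simp add: blinfun.diff_left)
        moreover have "\<bar>a - c\<bar> \<le> (e + d) / 2" if "\<bar>a - b\<bar> \<le> (e - d) / 2" "\<bar>b - c\<bar> \<le> d" for a b c :: real
          using that by argo
        ultimately show ?thesis using d(2)[OF x] by blast
      qed
      moreover have "(e + d) / 2 < e" using d(1) by simp
      ultimately show ?thesis unfolding V by blast
    qed
    with s show "\<exists>s>0. \<forall>g'. dist g' g < s \<longrightarrow> g' \<in> V" by blast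
  qed
qed (auto intro: open_Union)

lemma continuous_map_euclidean_mackey: "continuous_map euclidean mackey_topology id"
  unfolding continuous_map_def using open_mackey by auto

lemma Hausdorff_mackey: "Hausdorff_space (mackey_topology :: ('a::banach \<Rightarrow>\<^sub>L real) topology)"
  unfolding Hausdorff_space_def
proof (intro allI impI)
  fix f g :: "'a \<Rightarrow>\<^sub>L real"
  assume "f \<in> topspace mackey_topology \<and> g \<in> topspace mackey_topology \<and> f \<noteq> g"
  then obtain x where x: "f x \<noteq> g x" by (metis blinfun_eqI)
  obtain K where K: "x \<in> K" "compactin weak_topology K" "absolutely_convex K"
    by (rule point_in_mackey_set)
  define e where "e = \<bar>f x - g x\<bar> / 2"
  have e: "e > 0" using x unfolding e_def by simp
  let ?N = "\<lambda>h :: 'a \<Rightarrow>\<^sub>L real. {g. \<exists>d<e. \<forall>x\<in>K. \<bar>blinfun_apply g x - blinfun_apply h x\<bar> \<le> d}"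
  have dj: "disjnt (?N f) (?N g)"
  proof -
    have False if "\<bar>h x - f x\<bar> \<le> c" "c < e" "\<bar>h x - g x\<bar> \<le> d" "d < e" for h :: "'a \<Rightarrow>\<^sub>L real" and c d
      using that unfolding e_def by argo
    then show ?thesis using K(1) unfolding disjnt_iff by blast
  qed
  have mem: "h \<in> ?N h" for h using e by (auto intro: exI[of _ 0])
  show "\<exists>U V. openin mackey_topology U \<and> openin mackey_topology V \<and> f \<in> U \<and> g \<in> V \<and> disjnt U V"
    by (rule exI[of _ "?N f"], rule exI[of _ "?N g"]) (intro conjI openin_mackey_ball[OF K(2,3) e] mem dj)
qed

lemma compact_closure_totally_bounded:
  fixes A :: "'b::complete_space set"
  assumes "\<And>e. e > 0 \<Longrightarrow> \<exists>k. finite k \<and> A \<subseteq> (\<Union>x\<in>k. ball x e)"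
  shows "compact (closure A)"
  unfolding compact_eq_totally_bounded
proof (intro conjI allI impI)
  show "complete (closure A)" by (simp add: complete_eq_closed)
  fix e :: real assume "e > 0"
  then obtain k where k: "finite k" "A \<subseteq> (\<Union>x\<in>k. ball x (e / 2))" using assms[of "e / 2"] by auto
  have "closure A \<subseteq> (\<Union>x\<in>k. cball x (e / 2))"
  proof (rule closure_minimal)
    show "A \<subseteq> (\<Union>x\<in>k. cball x (e / 2))" using k(2) ball_subset_cball by blast
    show "closed (\<Union>x\<in>k. cball x (e / 2))" using k(1) by (intro closed_UN) auto
  qed
  also have "\<dots> \<subseteq> (\<Union>x\<in>k. ball x e)" using \<open>e > 0\<close> by (intro UN_mono) auto
  finally show "\<exists>k. finite k \<and> closure A \<subseteq> (\<Union>x\<in>k. ball x e)" using k(1) by blast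
qed

lemma totally_bounded_or_separated:
  fixes A :: "'b::metric_space set"
  assumes "\<nexists>k. finite k \<and> A \<subseteq> (\<Union>x\<in>k. ball x e)"
  obtains f :: "nat \<Rightarrow> 'b" where "range f \<subseteq> A" "\<And>m n. m < n \<Longrightarrow> dist (f m) (f n) \<ge> e"
proof -
  have "\<exists>f. \<forall>n::nat. f n \<in> A \<and> (\<forall>m<n. dist (f m) (f n) \<ge> e)"
  proof (rule dependent_wellorder_choice)
    fix n :: nat and f :: "nat \<Rightarrow> 'b"
    have "\<not> A \<subseteq> (\<Union>x\<in>f ` {..<n}. ball x e)" using assms by blast
    then show "\<exists>x. x \<in> A \<and> (\<forall>m<n. dist (f m) x \<ge> e)" by (auto simp: not_less)
  qed auto
  then show ?thesis using that by (auto simp: image_subset_iff)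
qed

lemma relatively_countably_compact_mackey_cluster:
  fixes f :: "nat \<Rightarrow> 'a::real_normed_vector \<Rightarrow>\<^sub>L real"
  assumes "relatively_countably_compactin mackey_topology A" "range f \<subseteq> A"
  obtains g :: "'a \<Rightarrow>\<^sub>L real" where "\<And>K e. \<lbrakk>compactin weak_topology K; absolutely_convex K; e > 0\<rbrakk> \<Longrightarrow>
    \<exists>\<^sub>F n in sequentially. \<forall>x\<in>K. \<bar>blinfun_apply (f n) x - blinfun_apply g x\<bar> < e"
proof -
  obtain g :: "'a \<Rightarrow>\<^sub>L real" where g: "\<And>U. openin mackey_topology U \<Longrightarrow> g \<in> U \<Longrightarrow> \<exists>\<^sub>F n in sequentially. f n \<in> U"
    using assms(1)[unfolded relatively_countably_compactin_def, THEN conjunct2, rule_format, OF assms(2)] by auto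
  show thesis
  proof (rule that[of g])
    fix K :: "'a set" and e :: real assume K: "compactin weak_topology K" "absolutely_convex K" "e > 0"
    let ?U = "{h. \<exists>d<e. \<forall>x\<in>K. \<bar>blinfun_apply h x - blinfun_apply g x\<bar> \<le> d}"
    have "g \<in> ?U" using K(3) by (auto intro: exI[of _ 0])
    with g[OF openin_mackey_ball[OF K]] have "\<exists>\<^sub>F n in sequentially. f n \<in> ?U" .
    then show "\<exists>\<^sub>F n in sequentially. \<forall>x\<in>K. \<bar>blinfun_apply (f n) x - blinfun_apply g x\<bar> < e"
      by (rule frequently_elim1) (auto intro: le_less_trans)
  qed
qed

text \<open>The norm compact closure of \<open>A\<close> is Mackey compact and hence Mackey closed,
  so it contains the Mackey closure. Its points are norm limits of sequences from \<open>A\<close>,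
  and norm limits are Mackey limits.\<close>

theorem no_ell1_imp_angelic_mackey:
  assumes ell1: "\<not> contains_ell1 TYPE('a::banach)"
  shows "angelic_space (mackey_topology :: ('a \<Rightarrow>\<^sub>L real) topology)"
  unfolding angelic_space_def
proof (intro conjI allI impI Hausdorff_mackey)
  fix A :: "('a \<Rightarrow>\<^sub>L real) set"
  assume A: "relatively_countably_compactin mackey_topology A"
  have "\<exists>k. finite k \<and> A \<subseteq> (\<Union>x\<in>k. ball x e)" if e: "e > 0" for e
  proof (rule ccontr)
    assume "\<not> ?thesis"
    then obtain f :: "nat \<Rightarrow> 'a \<Rightarrow>\<^sub>L real" where f: "range f \<subseteq> A" "\<And>m n. m < n \<Longrightarrow> dist (f m) (f n) \<ge> e"
      using totally_bounded_or_separated by blast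
    show False
    proof (rule no_separated_mackey_clustering_sequence[OF ell1 _ _ e])
      fix r :: "nat \<Rightarrow> nat"
      have "range (\<lambda>n. f (r n)) \<subseteq> A" using f(1) by auto
      then obtain g :: "'a \<Rightarrow>\<^sub>L real" where
        "\<And>K e. \<lbrakk>compactin weak_topology K; absolutely_convex K; e > 0\<rbrakk> \<Longrightarrow>
          \<exists>\<^sub>F n in sequentially. \<forall>x\<in>K. \<bar>blinfun_apply (f (r n)) x - blinfun_apply g x\<bar> < e"
        by (rule relatively_countably_compact_mackey_cluster[OF A]) blast
      then show "\<exists>g :: 'a \<Rightarrow>\<^sub>L real. \<forall>K e. compactin weak_topology K \<and> absolutely_convex K \<and> e > 0 \<longrightarrow>
          (\<exists>\<^sub>F n in sequentially. \<forall>x\<in>K. \<bar>f (r n) x - g x\<bar> < e)" by blast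
    qed (use f(2) in \<open>simp add: dist_norm\<close>)
  qed
  then have "compact (closure A)" by (rule compact_closure_totally_bounded)
  then have comp: "compactin mackey_topology (closure A)"
    using image_compactin[OF _ continuous_map_euclidean_mackey, of "closure A"] by simp
  then have "closedin mackey_topology (closure A)"
    using Hausdorff_mackey by (intro compactin_imp_closedin)
  then have sub: "mackey_topology closure_of A \<subseteq> closure A"
    by (intro closure_of_minimal closure_subset)
  show "compactin mackey_topology (mackey_topology closure_of A)"
    by (rule closed_compactin[OF comp sub closedin_closure_of])
  show "\<forall>a\<in>mackey_topology closure_of A. \<exists>s. range s \<subseteq> A \<and> limitin mackey_topology s a sequentially"
  proof
    fix a assume "a \<in> mackey_topology closure_of A"
    then have "a \<in> closure A" using sub by blast
    then obtain s where s: "\<And>n. s n \<in> A" "s \<longlonglongrightarrow> a" by (auto simp: closure_sequential)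
    have "limitin mackey_topology s a sequentially"
      unfolding limitin_def using open_mackey topological_tendstoD[OF s(2)] by auto
    with s(1) show "\<exists>s. range s \<subseteq> A \<and> limitin mackey_topology s a sequentially" by blast
  qed
qed

section \<open>The Hahn--Banach theorem\<close>

text \<open>The inequality for positive \<open>t\<close>, applied also to \<open>1 / t\<close>,
  gives equality; in this form homogeneity is easier to check for infima.\<close>

definition sublinear :: "('a::real_vector \<Rightarrow> real) \<Rightarrow> bool" where
  "sublinear p \<longleftrightarrow> (\<forall>x y. p (x + y) \<le> p x + p y) \<and> (\<forall>t>0. \<forall>x. p (t *\<^sub>R x) \<le> t * p x)"

lemma sublinear_add: "sublinear p \<Longrightarrow> p (x + y) \<le> p x + p y"
  and sublinear_scaleR_le: "sublinear p \<Longrightarrow> t > 0 \<Longrightarrow> p (t *\<^sub>R x) \<le> t * p x"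
  unfolding sublinear_def by blast+

lemma sublinear_zero: "sublinear p \<Longrightarrow> p 0 = 0"
  using sublinear_scaleR_le[of p 2 0] sublinear_scaleR_le[of p "1/2" 0] by simp

lemma sublinear_scaleR:
  assumes "sublinear p" "t \<ge> 0"
  shows "p (t *\<^sub>R x) = t * p x"
proof (cases "t = 0")
  case True
  then show ?thesis using sublinear_zero[OF assms(1)] by simp
next
  case False
  with assms(2) have t: "t > 0" by simp
  then have "p ((1 / t) *\<^sub>R (t *\<^sub>R x)) \<le> (1 / t) * p (t *\<^sub>R x)"
    by (intro sublinear_scaleR_le[OF assms(1)]) simp
  then have "t * p x \<le> p (t *\<^sub>R x)" using t by (simp add: field_simps)
  with sublinear_scaleR_le[OF assms(1) t, of x] show ?thesis by simp
qed

lemma sublinear_minus_ge: "sublinear p \<Longrightarrow> - p (- x) \<le> p x"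
  using sublinear_add[of p x "- x"] sublinear_zero[of p] by simp

lemma sublinear_add_minus_ge: "sublinear p \<Longrightarrow> p y - p (- x) \<le> p (x + y)"
  using sublinear_add[of p "x + y" "- x"] by simp

text \<open>Any sublinear \<open>q \<le> p\<close> is bounded below by \<open>- p (- x)\<close>, so
  the infimum is finite. For subadditivity two members of the chain are replaced by the smaller
  one.\<close>

lemma sublinear_INF_chain:
  assumes "C \<noteq> {}" and C: "\<And>q. q \<in> C \<Longrightarrow> sublinear q \<and> q \<le> p"
    and chain: "\<And>q q'. q \<in> C \<Longrightarrow> q' \<in> C \<Longrightarrow> q \<le> q' \<or> q' \<le> q"
  shows "sublinear (\<lambda>x. INF q\<in>C. q x)" and "\<And>q. q \<in> C \<Longrightarrow> (\<lambda>x. INF q\<in>C. q x) \<le> q"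
proof -
  have bdd: "bdd_below ((\<lambda>q. q x) ` C)" for x
  proof (rule bdd_belowI2)
    fix q assume q: "q \<in> C"
    have "- p (- x) \<le> - q (- x)" using C[OF q] by (simp add: le_fun_def)
    also have "\<dots> \<le> q x" using C[OF q] sublinear_minus_ge by blast
    finally show "- p (- x) \<le> q x" .
  qed
  have le: "(INF q\<in>C. q x) \<le> q x" if "q \<in> C" for q x
    using bdd that by (rule cINF_lower)
  then show "\<And>q. q \<in> C \<Longrightarrow> (\<lambda>x. INF q\<in>C. q x) \<le> q" by (auto simp: le_fun_def)
  have ge: "c \<le> (INF q\<in>C. q x)" if "\<And>q. q \<in> C \<Longrightarrow> c \<le> q x" for c x
    using assms(1) that by (rule cINF_greatest)
  show "sublinear (\<lambda>x. INF q\<in>C. q x)"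
    unfolding sublinear_def
  proof (intro conjI allI impI)
    fix x y
    have two: "(INF q\<in>C. q (x + y)) \<le> q1 x + q2 y" if q: "q1 \<in> C" "q2 \<in> C" for q1 q2
    proof -
      obtain q where q': "q \<in> C" "q \<le> q1" "q \<le> q2" using chain[OF q] q by auto
      have "(INF q\<in>C. q (x + y)) \<le> q (x + y)" by (rule le[OF q'(1)])
      also have "\<dots> \<le> q x + q y" using C[OF q'(1)] sublinear_add by blast
      also have "\<dots> \<le> q1 x + q2 y" using q' by (intro add_mono) (auto simp: le_fun_def)
      finally show ?thesis .
    qed
    have "(INF q\<in>C. q (x + y)) - (INF q\<in>C. q x) \<le> q2 y" if "q2 \<in> C" for q2
    proof -
      have "(INF q\<in>C. q (x + y)) - q2 y \<le> (INF q\<in>C. q x)"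
        using two that by (intro ge) (simp add: diff_le_eq)
      then show ?thesis by simp
    qed
    then have "(INF q\<in>C. q (x + y)) - (INF q\<in>C. q x) \<le> (INF q\<in>C. q y)" by (rule ge)
    then show "(INF q\<in>C. q (x + y)) \<le> (INF q\<in>C. q x) + (INF q\<in>C. q y)" by simp
  next
    fix t :: real and x assume t: "t > 0"
    have "(INF q\<in>C. q (t *\<^sub>R x)) / t \<le> (INF q\<in>C. q x)"
    proof (rule ge)
      fix q assume q: "q \<in> C"
      have "(INF q\<in>C. q (t *\<^sub>R x)) \<le> q (t *\<^sub>R x)" by (rule le[OF q])
      also have "\<dots> \<le> t * q x" using C[OF q] t sublinear_scaleR_le by blast
      finally show "(INF q\<in>C. q (t *\<^sub>R x)) / t \<le> q x" using t by (simp add: field_simps)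
    qed
    then show "(INF q\<in>C. q (t *\<^sub>R x)) \<le> t * (INF q\<in>C. q x)" using t by (simp add: field_simps)
  qed
qed

text \<open>Lowering \<open>m\<close> in direction \<open>z\<close> gives a sublinear
  \<open>q\<close>, below \<open>m\<close> by the choice \<open>t = 0\<close>. Minimality forces
  \<open>q = m\<close>, and \<open>t = 1\<close> is the claim.\<close>

lemma minimal_sublinear_superadditive:
  assumes m: "sublinear m" and min: "\<And>q. sublinear q \<Longrightarrow> q \<le> m \<Longrightarrow> q = m"
  shows "m x + m z \<le> m (x + z)"
proof -
  define q where "q x = (INF t\<in>{0..}. m (x + t *\<^sub>R z) - t * m z)" for x
  have bdd: "bdd_below ((\<lambda>t. m (x + t *\<^sub>R z) - t * m z) ` {0..})" for x
  proof (rule bdd_belowI2)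
    fix t :: real assume "t \<in> {0..}"
    then show "- m (- x) \<le> m (x + t *\<^sub>R z) - t * m z"
      using sublinear_add_minus_ge[OF m, of "t *\<^sub>R z" x] sublinear_scaleR[OF m, of t z] by simp
  qed
  have le: "q x \<le> m (x + t *\<^sub>R z) - t * m z" if "t \<ge> 0" for x t
    unfolding q_def using bdd by (rule cINF_lower) (use that in simp)
  have ge: "c \<le> q x" if "\<And>t. t \<ge> 0 \<Longrightarrow> c \<le> m (x + t *\<^sub>R z) - t * m z" for c x
    unfolding q_def by (rule cINF_greatest) (use that in auto)
  have "sublinear q"
    unfolding sublinear_def
  proof (intro conjI allI impI)
    fix x y
    have two: "q (x + y) \<le> (m (x + s *\<^sub>R z) - s * m z) + (m (y + t *\<^sub>R z) - t * m z)" if "s \<ge> 0" "t \<ge> 0" for s t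
    proof -
      have "q (x + y) \<le> m ((x + y) + (s + t) *\<^sub>R z) - (s + t) * m z" using that by (intro le) simp
      moreover have "m ((x + y) + (s + t) *\<^sub>R z) \<le> m (x + s *\<^sub>R z) + m (y + t *\<^sub>R z)"
        using sublinear_add[OF m, of "x + s *\<^sub>R z" "y + t *\<^sub>R z"] by (simp add: algebra_simps)
      ultimately show ?thesis by (simp add: algebra_simps)
    qed
    have "q (x + y) - q x \<le> m (y + t *\<^sub>R z) - t * m z" if "t \<ge> 0" for t
    proof -
      have "q (x + y) - (m (y + t *\<^sub>R z) - t * m z) \<le> q x"
        using two[OF _ that] by (intro ge) (simp add: diff_le_eq)
      then show ?thesis by simp
    qed
    then have "q (x + y) - q x \<le> q y" by (rule ge)
    then show "q (x + y) \<le> q x + q y" by simp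
  next
    fix c :: real and x assume c: "c > 0"
    have "q (c *\<^sub>R x) / c \<le> q x"
    proof (rule ge)
      fix t :: real assume t: "t \<ge> 0"
      have "q (c *\<^sub>R x) \<le> m (c *\<^sub>R x + (c * t) *\<^sub>R z) - (c * t) * m z"
        using c t by (intro le) simp
      also have "c *\<^sub>R x + (c * t) *\<^sub>R z = c *\<^sub>R (x + t *\<^sub>R z)" by (simp add: scaleR_add_right)
      also have "m \<dots> \<le> c * m (x + t *\<^sub>R z)" using sublinear_scaleR_le[OF m c] .
      finally show "q (c *\<^sub>R x) / c \<le> m (x + t *\<^sub>R z) - t * m z"
        using c by (simp add: field_simps)
    qed
    then show "q (c *\<^sub>R x) \<le> c * q x" using c by (simp add: field_simps)
  qed
  moreover have "q \<le> m" using le[of 0] by (simp add: le_fun_def)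
  ultimately have "q = m" by (rule min)
  then show ?thesis using le[of 1 x] by simp
qed

theorem sublinear_dominates_linear:
  assumes p: "sublinear p"
  obtains f where "linear f" "\<And>x. f x \<le> p x"
proof -
  define A where "A = {q. sublinear q \<and> q \<le> p}"
  have "\<exists>m\<in>A. \<forall>q\<in>A. q \<le> m \<longrightarrow> q = m"
  proof (rule predicate_Zorn)
    show "partial_order_on A (relation_of (\<lambda>q q'. q' \<le> q) A)"
      by (rule partial_order_on_relation_ofI) auto
    fix C assume "C \<in> Chains (relation_of (\<lambda>q q'. q' \<le> q) A)"
    then have C: "C \<subseteq> A" "\<And>a b. a \<in> C \<Longrightarrow> b \<in> C \<Longrightarrow> a \<le> b \<or> b \<le> a"
      by (auto simp: Chains_def relation_of_def)
    show "\<exists>u\<in>A. \<forall>q\<in>C. u \<le> q"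
    proof (cases "C = {}")
      case True
      then show ?thesis using p by (auto simp: A_def)
    next
      case False
      have C': "sublinear q \<and> q \<le> p" if "q \<in> C" for q
        using C(1) that by (auto simp: A_def)
      have u1: "sublinear (\<lambda>x. INF q\<in>C. q x)"
        by (rule sublinear_INF_chain(1)[OF False C' C(2)])
      have u2: "(\<lambda>x. INF q\<in>C. q x) \<le> q" if "q \<in> C" for q
        by (rule sublinear_INF_chain(2)[OF False C' C(2) that])
      obtain q where q: "q \<in> C" using False by blast
      have "(\<lambda>x. INF q\<in>C. q x) \<le> p"
        using u2[OF q] C'[OF q] by (blast intro: order_trans)
      with u1 have "(\<lambda>x. INF q\<in>C. q x) \<in> A" unfolding A_def by simp
      with u2 show ?thesis by (intro bexI[of _ "\<lambda>x. INF q\<in>C. q x"]) auto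
    qed
  qed
  then obtain m where m: "sublinear m" "m \<le> p" and min: "\<And>q. q \<in> A \<Longrightarrow> q \<le> m \<Longrightarrow> q = m"
    unfolding A_def by blast
  have "q = m" if "sublinear q" "q \<le> m" for q
    using that m(2) by (intro min) (auto simp: A_def)
  then have add: "m (x + y) = m x + m y" for x y
    using minimal_sublinear_superadditive[OF m(1), of x y] sublinear_add[OF m(1), of x y] by force
  have neg: "m (- x) = - m x" for x
    using add[of x "- x"] sublinear_zero[OF m(1)] by simp
  have "m (c *\<^sub>R x) = c * m x" for c x
  proof (cases "c \<ge> 0")
    case True
    then show ?thesis by (rule sublinear_scaleR[OF m(1)])
  next
    case False
    then have "m ((- c) *\<^sub>R x) = - c * m x" by (intro sublinear_scaleR[OF m(1)]) simp
    then show ?thesis using neg[of "c *\<^sub>R x"] by simp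
  qed
  with add have "linear m" by (intro linearI) auto
  then show thesis using m(2) that by (auto simp: le_fun_def)
qed

text \<open>Infimal convolution merges the norm bound and \<open>\<phi>\<close> into one sublinear
  \<open>p\<close> on the whole space. The hypothesis \<open>le\<close>, applied to \<open>v\<close>
  and \<open>- v\<close>, makes \<open>\<phi>\<close> vanish on the kernel of \<open>T\<close>, so
  it is a functional on the range.\<close>

theorem hahn_banach_along:
  fixes T :: "'v::real_vector \<Rightarrow> 'a::real_normed_vector"
  assumes T: "linear T" and \<phi>: "linear \<phi>" and le: "\<And>v. \<phi> v \<le> C * norm (T v)" and C: "C \<ge> 0"
  obtains g :: "'a \<Rightarrow>\<^sub>L real" where "norm g \<le> C" "\<And>v. g (T v) = \<phi> v"
proof -
  define p where "p x = (INF v. C * norm (x + T v) - \<phi> v)" for x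
  have low: "- C * norm x \<le> C * norm (x + T v) - \<phi> v" for x v
  proof -
    have "C * norm (T v) \<le> C * (norm (x + T v) + norm x)"
      using C norm_triangle_ineq4[of "x + T v" x] by (intro mult_left_mono) simp_all
    then show ?thesis using le[of v] by (simp add: algebra_simps)
  qed
  have bdd: "bdd_below (range (\<lambda>v. C * norm (x + T v) - \<phi> v))" for x
    by (rule bdd_belowI2[where m = "- C * norm x"]) (rule low)
  have p_le: "p x \<le> C * norm (x + T v) - \<phi> v" for x v
    unfolding p_def using bdd by (rule cINF_lower) simp
  have p_ge: "c \<le> p x" if "\<And>v. c \<le> C * norm (x + T v) - \<phi> v" for c x
    unfolding p_def by (rule cINF_greatest) (use that in auto)
  have "sublinear p"
    unfolding sublinear_def
  proof (intro conjI allI impI)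
    fix x y
    have two: "p (x + y) \<le> (C * norm (x + T v) - \<phi> v) + (C * norm (y + T w) - \<phi> w)" for v w
    proof -
      have "p (x + y) \<le> C * norm ((x + T v) + (y + T w)) - (\<phi> v + \<phi> w)"
        using p_le[of "x + y" "v + w"] by (simp add: linear_add[OF T] linear_add[OF \<phi>] algebra_simps)
      also have "\<dots> \<le> C * (norm (x + T v) + norm (y + T w)) - (\<phi> v + \<phi> w)"
        using C norm_triangle_ineq by (intro diff_right_mono mult_left_mono)
      finally show ?thesis by (simp add: algebra_simps)
    qed
    have "p (x + y) - p x \<le> C * norm (y + T w) - \<phi> w" for w
    proof -
      have "p (x + y) - (C * norm (y + T w) - \<phi> w) \<le> p x"
        using two by (intro p_ge) (simp add: diff_le_eq)
      then show ?thesis by simp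
    qed
    then have "p (x + y) - p x \<le> p y" by (rule p_ge)
    then show "p (x + y) \<le> p x + p y" by simp
  next
    fix c :: real and x assume c: "c > 0"
    have "p (c *\<^sub>R x) / c \<le> p x"
    proof (rule p_ge)
      fix v
      have "p (c *\<^sub>R x) \<le> C * norm (c *\<^sub>R x + T (c *\<^sub>R v)) - \<phi> (c *\<^sub>R v)" by (rule p_le)
      also have "\<dots> = C * norm (c *\<^sub>R (x + T v)) - c * \<phi> v"
        by (simp add: linear_cmul[OF T] linear_cmul[OF \<phi>] scaleR_add_right)
      also have "\<dots> = c * (C * norm (x + T v) - \<phi> v)"
        unfolding norm_scaleR using c by (simp add: algebra_simps)
      finally show "p (c *\<^sub>R x) / c \<le> C * norm (x + T v) - \<phi> v" using c by (simp add: field_simps)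
    qed
    then show "p (c *\<^sub>R x) \<le> c * p x" using c by (simp add: field_simps)
  qed
  then obtain f where f: "linear f" "\<And>x. f x \<le> p x"
    by (rule sublinear_dominates_linear) blast
  have fb: "f x \<le> C * norm x" for x
    using f(2)[of x] p_le[of x 0] by (simp add: linear_0[OF T] linear_0[OF \<phi>])
  have fn: "norm (f x) \<le> norm x * C" for x
    using fb[of x] fb[of "- x"] by (simp add: linear_neg[OF f(1)] abs_le_iff mult.commute)
  have "bounded_linear f"
    using f(1) fn by (intro bounded_linear_intro[of f C]) (auto simp: linear_add linear_cmul)
  then have app: "blinfun_apply (Blinfun f) = f" by (rule bounded_linear_Blinfun_apply)
  \<comment> \<open>The index \<open>- v\<close> in the infimum cancels the norm term; applying the
    result to \<open>- v\<close> turns the inequality into equality.\<close>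
  have fT: "f (T v) \<le> \<phi> v" for v
    using f(2)[of "T v"] p_le[of "T v" "- v"] by (simp add: linear_neg[OF T] linear_neg[OF \<phi>])
  have "f (T v) = \<phi> v" for v
    using fT[of v] fT[of "- v"] by (simp add: linear_neg[OF T] linear_neg[OF \<phi>] linear_neg[OF f(1)])
  moreover have "norm (Blinfun f) \<le> C"
    using fn C by (intro norm_blinfun_bound) (simp_all add: app mult.commute)
  ultimately show thesis using that[of "Blinfun f"] by (simp add: app)
qed

section \<open>Finitely additive measures\<close>

locale finitely_additive =
  fixes \<mu> :: "'b set \<Rightarrow> real"
  assumes nonneg: "\<mu> A \<ge> 0" and le_one: "\<mu> A \<le> 1"
    and add: "A \<inter> B = {} \<Longrightarrow> \<mu> (A \<union> B) = \<mu> A + \<mu> B"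
begin

lemma empty: "\<mu> {} = 0"
  using add[of "{}" "{}"] by simp

lemma mono: "A \<subseteq> B \<Longrightarrow> \<mu> A \<le> \<mu> B"
  using add[of A "B - A"] nonneg[of "B - A"] by (simp add: Un_absorb1)

lemma modular: "\<mu> (A \<union> B) = \<mu> A + \<mu> B - \<mu> (A \<inter> B)"
proof -
  have "\<mu> (A \<union> B) = \<mu> A + \<mu> (B - A)"
    using add[of A "B - A"] by simp
  moreover have "\<mu> B = \<mu> (A \<inter> B) + \<mu> (B - A)"
  proof -
    have "(A \<inter> B) \<union> (B - A) = B" "(A \<inter> B) \<inter> (B - A) = {}" by auto
    then show ?thesis using add[of "A \<inter> B" "B - A"] by simp
  qed
  ultimately show ?thesis by simp
qed

lemma subadditive_sum: "finite I \<Longrightarrow> \<mu> (\<Union>i\<in>I. A i) \<le> (\<Sum>i\<in>I. \<mu> (A i))"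
proof (induction rule: finite_induct)
  case (insert i I)
  then show ?case using modular[of "A i" "\<Union>i\<in>I. A i"] nonneg[of "A i \<inter> (\<Union>i\<in>I. A i)"] by simp
qed (simp add: empty)

text \<open>Otherwise arbitrarily many sets could be chosen with tiny pairwise overlaps, and the
  measure of their union would exceed 1.\<close>

lemma frequent_intersections:
  fixes A :: "nat \<Rightarrow> 'b set"
  assumes c: "c > 0" and large: "\<And>k. \<mu> (A k) \<ge> c"
  obtains d k where "d > 0" "\<exists>\<^sub>F j in sequentially. \<mu> (A k \<inter> A j) \<ge> d"
proof (rule ccontr)
  assume no: "\<not> thesis"
  \<comment> \<open>Overlap with at most \<open>m\<close> earlier sets costs at most
    \<open>m * d = c / 2\<close>, so each new set adds \<open>c / 2\<close>, and
    \<open>m > 2 / c\<close> sets are too many.\<close>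
  obtain m :: nat where m: "2 / c < m" using reals_Archimedean2 by blast
  have "m > 0" using m c by (smt (verit) divide_pos_pos of_nat_0_less_iff)
  define d where "d = c / (2 * m)"
  have d: "d > 0" unfolding d_def using c \<open>m > 0\<close> by simp
  have ev: "\<forall>\<^sub>F j in sequentially. \<mu> (A k \<inter> A j) < d" for k
    using no that[OF d, of k] by (auto simp: frequently_def not_le)
  have "\<exists>p :: nat \<Rightarrow> nat. \<forall>n. \<forall>i<n. \<mu> (A (p i) \<inter> A (p n)) < d"
  proof (rule dependent_wellorder_choice)
    fix n :: nat and p :: "nat \<Rightarrow> nat"
    have "\<forall>\<^sub>F j in sequentially. \<forall>i\<in>{..<n}. \<mu> (A (p i) \<inter> A j) < d"
      by (intro eventually_ball_finite) (use ev in auto)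
    then show "\<exists>j. \<forall>i<n. \<mu> (A (p i) \<inter> A j) < d"
      by (auto simp: eventually_sequentially)
  qed auto
  then obtain p :: "nat \<Rightarrow> nat" where p: "\<And>i n. i < n \<Longrightarrow> \<mu> (A (p i) \<inter> A (p n)) < d" by blast
  have "real n * (c / 2) \<le> \<mu> (\<Union>i<n. A (p i))" if "n \<le> m" for n
    using that
  proof (induction n)
    case (Suc n)
    have "\<mu> ((\<Union>i<n. A (p i)) \<inter> A (p n)) = \<mu> (\<Union>i<n. A (p i) \<inter> A (p n))"
      by (rule arg_cong[of _ _ \<mu>]) auto
    also have "\<dots> \<le> (\<Sum>i<n. \<mu> (A (p i) \<inter> A (p n)))"
      by (rule subadditive_sum) simp
    also have "\<dots> \<le> (\<Sum>i<n. d)"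
      by (rule sum_mono) (use p in \<open>auto intro: less_imp_le\<close>)
    also have "\<dots> \<le> m * d" using Suc.prems d by (simp add: mult_right_mono)
    also have "\<dots> = c / 2" unfolding d_def using \<open>m > 0\<close> by simp
    finally have "\<mu> ((\<Union>i<n. A (p i)) \<inter> A (p n)) \<le> c / 2" .
    moreover have "(\<Union>i<Suc n. A (p i)) = (\<Union>i<n. A (p i)) \<union> A (p n)"
      by (auto simp: less_Suc_eq)
    ultimately have "\<mu> (\<Union>i<Suc n. A (p i)) \<ge> \<mu> (\<Union>i<n. A (p i)) + c / 2"
      using modular[of "\<Union>i<n. A (p i)" "A (p n)"] large[of "p n"] by simp
    then show ?case using Suc by (simp add: algebra_simps add_divide_distrib)
  qed (simp add: nonneg)
  from this[of m] have "real m * (c / 2) \<le> 1" using le_one order_trans by blast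
  with m c show False by (simp add: field_simps)
qed

text \<open>\<open>P B\<close> says that \<open>B\<close> meets infinitely many \<open>A j\<close>
  in measure bounded below. The preceding lemma, applied to these traces on \<open>B\<close>, finds
  a later \<open>A k\<close> with \<open>P (B \<inter> A k)\<close>. Iteration keeps
  \<open>P\<close>, and \<open>P\<close> excludes the empty set.\<close>

theorem infinite_subfamily_fip:
  fixes A :: "nat \<Rightarrow> 'b set"
  assumes c: "c > 0" and large: "\<And>k. \<mu> (A k) \<ge> c"
  obtains r where "strict_mono (r :: nat \<Rightarrow> nat)" "\<And>k. (\<Inter>i<k::nat. A (r i)) \<noteq> {}"
proof -
  define P where "P B \<longleftrightarrow> (\<exists>d>0. \<exists>\<^sub>F j in sequentially. \<mu> (B \<inter> A j) \<ge> d)" for B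
  have step: "\<exists>j>b. P (B \<inter> A j)" if PB: "P B" for B and b :: nat
  proof -
    obtain d where d: "d > 0" "\<exists>\<^sub>F j in sequentially. \<mu> (B \<inter> A j) \<ge> d" using PB P_def by auto
    have "\<exists>\<^sub>F j in sequentially. \<mu> (B \<inter> A j) \<ge> d \<and> b < j"
      using d(2) eventually_gt_at_top by (rule frequently_eventually_frequently)
    then obtain q where q: "strict_mono (q :: nat \<Rightarrow> nat)" "\<And>k. \<mu> (B \<inter> A (q k)) \<ge> d \<and> b < q k"
      by (rule frequently_subseq1) blast
    obtain d' k where d': "d' > 0" "\<exists>\<^sub>F j in sequentially. \<mu> ((B \<inter> A (q k)) \<inter> (B \<inter> A (q j))) \<ge> d'"
      using frequent_intersections[OF d(1), of "\<lambda>j. B \<inter> A (q j)"] q(2) by blast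
    have "\<exists>\<^sub>F j in sequentially. \<mu> ((B \<inter> A (q k)) \<inter> A (q j)) \<ge> d'"
      using d'(2) by (rule frequently_elim1) (rule order_trans[OF _ mono], auto)
    then have "\<exists>\<^sub>F j in sequentially. \<mu> ((B \<inter> A (q k)) \<inter> A j) \<ge> d'"
      by (rule frequently_subseqD[OF q(1)])
    then have "P (B \<inter> A (q k))" unfolding P_def using d'(1) by blast
    with q(2)[of k] show ?thesis by blast
  qed
  have "\<exists>f. \<forall>n::nat. P (fst (f n)) \<and> (snd (f n) < snd (f (Suc n)) \<and> fst (f (Suc n)) = fst (f n) \<inter> A (snd (f (Suc n))))"
  proof (rule dependent_nat_choice)
    have "P UNIV" unfolding P_def using c large by (auto intro!: exI[of _ c])
    then show "\<exists>x :: 'b set \<times> nat. P (fst x)" by auto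
    fix x :: "'b set \<times> nat" and n :: nat assume "P (fst x)"
    then obtain j where "j > snd x" "P (fst x \<inter> A j)" using step by blast
    then show "\<exists>y. P (fst y) \<and> snd x < snd y \<and> fst y = fst x \<inter> A (snd y)"
      by (intro exI[of _ "(fst x \<inter> A j, j)"]) simp
  qed
  then obtain f where f: "\<And>n::nat. P (fst (f n))" "\<And>n. snd (f n) < snd (f (Suc n))"
    "\<And>n. fst (f (Suc n)) = fst (f n) \<inter> A (snd (f (Suc n)))" by blast
  define r where "r n = snd (f (Suc n))" for n
  have sm: "strict_mono r" unfolding r_def strict_mono_Suc_iff using f(2) by blast
  have sub: "fst (f k) \<subseteq> (\<Inter>i<k. A (r i))" for k
  proof (induction k)
    case (Suc k)
    then have "fst (f (Suc k)) \<subseteq> (\<Inter>i<k. A (r i)) \<inter> A (r k)"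
      using f(3)[of k] unfolding r_def by blast
    then show ?case by (simp add: lessThan_Suc Int_commute)
  qed simp
  have ne: "fst (f k) \<noteq> {}" for k
  proof
    assume "fst (f k) = {}"
    then have "P {}" using f(1)[of k] by simp
    then show False unfolding P_def by (auto simp: empty frequently_const_iff)
  qed
  show thesis
    by (rule that[OF sm]) (use sub ne in blast)
qed

end

section \<open>Averages over signs\<close>

text \<open>The Rademacher functions, a sign sequence being coded by the set of its positive
  positions. Summation over \<open>Pow {..<N}\<close> runs through all patterns of the first
  \<open>N\<close> signs.\<close>

definition sgn_of :: "nat set \<Rightarrow> nat \<Rightarrow> real" where
  "sgn_of t n = (if n \<in> t then 1 else -1)"

lemma sgn_of_mult_self [simp]: "sgn_of t n * sgn_of t n = 1"
  by (simp add: sgn_of_def)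

lemma abs_sgn_of [simp]: "\<bar>sgn_of t n\<bar> = 1"
  by (simp add: sgn_of_def)

lemma sum_sgn_of_mult:
  assumes "n < N"
  shows "(\<Sum>t\<in>Pow {..<N}. sgn_of t n * sgn_of t m) = (if n = m then 2 ^ N else 0)"
proof (cases "n = m")
  case True
  then show ?thesis by (simp add: card_Pow)
next
  case False
  \<comment> \<open>Toggling \<open>n < N\<close> is an involution of \<open>Pow {..<N}\<close> that
    reverses the sign at \<open>n\<close> and keeps the one at \<open>m\<close>.\<close>
  define flip where "flip t = (if n \<in> t then t - {n} else insert n t)" for t
  have "(\<Sum>t\<in>Pow {..<N}. sgn_of t n * sgn_of t m) = (\<Sum>t\<in>Pow {..<N}. - (sgn_of t n * sgn_of t m))"
    by (rule sum.reindex_bij_witness[of _ flip flip])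
       (use assms False in \<open>auto simp: flip_def sgn_of_def split: if_splits\<close>)
  then show ?thesis using False by (simp add: sum_negf)
qed

lemma bessel_signs:
  fixes u :: "nat set \<Rightarrow> real"
  assumes u: "\<And>t. \<bar>u t\<bar> \<le> D" and MN: "M \<le> N"
  shows "(\<Sum>n<M. ((\<Sum>t\<in>Pow {..<N}. sgn_of t n * u t) / 2 ^ N)\<^sup>2) \<le> D\<^sup>2"
proof -
  define c where "c n = (\<Sum>t\<in>Pow {..<N}. sgn_of t n * u t) / 2 ^ N" for n
  \<comment> \<open>The orthogonal projection of \<open>u\<close> onto the first \<open>M\<close>
    Rademacher functions; Bessel's inequality is the nonnegativity of the squared distance from
    \<open>u\<close> to \<open>w\<close>.\<close>
  define w where "w t = (\<Sum>n<M. c n * sgn_of t n)" for t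
  let ?P = "Pow {..<N}"
  have c2: "(\<Sum>t\<in>?P. sgn_of t n * u t) = 2 ^ N * c n" for n unfolding c_def by simp
  have wu: "(\<Sum>t\<in>?P. w t * u t) = 2 ^ N * (\<Sum>n<M. (c n)\<^sup>2)"
  proof -
    have "(\<Sum>t\<in>?P. w t * u t) = (\<Sum>t\<in>?P. \<Sum>n<M. c n * (sgn_of t n * u t))"
      unfolding w_def by (simp add: sum_distrib_right mult.assoc)
    also have "\<dots> = (\<Sum>n<M. \<Sum>t\<in>?P. c n * (sgn_of t n * u t))" by (rule sum.swap)
    also have "\<dots> = (\<Sum>n<M. c n * (2 ^ N * c n))" by (simp add: sum_distrib_left[symmetric] c2)
    finally show ?thesis by (simp add: sum_distrib_left power2_eq_square mult_ac)
  qed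
  have ww: "(\<Sum>t\<in>?P. w t * w t) = 2 ^ N * (\<Sum>n<M. (c n)\<^sup>2)"
  proof -
    have "(\<Sum>t\<in>?P. w t * w t) = (\<Sum>t\<in>?P. \<Sum>n<M. \<Sum>m<M. c n * c m * (sgn_of t n * sgn_of t m))"
      unfolding w_def by (simp add: sum_product mult_ac)
    also have "\<dots> = (\<Sum>n<M. \<Sum>t\<in>?P. \<Sum>m<M. c n * c m * (sgn_of t n * sgn_of t m))" by (rule sum.swap)
    also have "\<dots> = (\<Sum>n<M. \<Sum>m<M. \<Sum>t\<in>?P. c n * c m * (sgn_of t n * sgn_of t m))"
      by (intro sum.cong refl sum.swap)
    also have "\<dots> = (\<Sum>n<M. \<Sum>m<M. c n * c m * (if n = m then 2 ^ N else 0))"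
      using MN by (intro sum.cong refl) (simp add: sum_distrib_left[symmetric] sum_sgn_of_mult)
    also have "\<dots> = (\<Sum>n<M. \<Sum>m<M. if n = m then c n * c m * 2 ^ N else 0)"
      by (intro sum.cong refl) simp
    also have "\<dots> = (\<Sum>n<M. c n * c n * 2 ^ N)"
      by (intro sum.cong refl) (simp add: sum.delta')
    finally show ?thesis by (simp add: sum_distrib_left power2_eq_square mult_ac)
  qed
  have "0 \<le> (\<Sum>t\<in>?P. (u t - w t)\<^sup>2)" by (rule sum_nonneg) simp
  also have "\<dots> = (\<Sum>t\<in>?P. (u t)\<^sup>2 - 2 * (w t * u t) + w t * w t)"
    by (intro sum.cong refl) (simp add: power2_eq_square algebra_simps)
  also have "\<dots> = (\<Sum>t\<in>?P. (u t)\<^sup>2) - 2 ^ N * (\<Sum>n<M. (c n)\<^sup>2)"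
    by (simp add: sum.distrib sum_subtractf sum_distrib_left[symmetric] wu ww)
  finally have "2 ^ N * (\<Sum>n<M. (c n)\<^sup>2) \<le> (\<Sum>t\<in>?P. (u t)\<^sup>2)" by simp
  also have "\<dots> \<le> (\<Sum>t\<in>?P. D\<^sup>2)"
    by (rule sum_mono) (use u in \<open>metis abs_ge_zero power2_abs power_mono\<close>)
  also have "\<dots> = 2 ^ N * D\<^sup>2" by (simp add: card_Pow)
  finally show ?thesis unfolding c_def by simp
qed

text \<open>Weak* compactness of dual balls, for sequences and along the fixed ultrafilter.\<close>

lemma ultra_limit_blinfun:
  fixes G :: "nat \<Rightarrow> 'a::real_normed_vector \<Rightarrow>\<^sub>L real"
  assumes G: "\<And>k. norm (G k) \<le> C"
  obtains h :: "'a \<Rightarrow>\<^sub>L real" where "\<And>x. ((\<lambda>k. G k x) \<longlongrightarrow> h x) nat_ultra"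
proof -
  have bd: "\<bar>G k x\<bar> \<le> norm x * C" for k x
    using norm_blinfun[of "G k" x] mult_right_mono[OF G[of k] norm_ge_zero[of x]] by (simp add: mult.commute)
  define l where "l x = Lim nat_ultra (\<lambda>k. G k x)" for x
  have l: "((\<lambda>k. G k x) \<longlongrightarrow> l x) nat_ultra" for x
    unfolding l_def by (rule bounded_tendsto_nat_ultra[OF bd])
  have "bounded_linear l"
  proof (rule bounded_linear_intro)
    show "l (x + y) = l x + l y" for x y
      using tendsto_add[OF l[of x] l[of y]] l[of "x + y"]
      by (auto simp: blinfun.add_right intro: tendsto_unique[OF nat_ultra_nontrivial])
    show "l (r *\<^sub>R x) = r *\<^sub>R l x" for r x
      using tendsto_scaleR[OF tendsto_const[of r] l[of x]] l[of "r *\<^sub>R x"]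
      by (auto simp: blinfun.scaleR_right intro: tendsto_unique[OF nat_ultra_nontrivial])
    show "norm (l x) \<le> norm x * C" for x
      using tendsto_norm[OF l[of x]] by (rule tendsto_upperbound) (use bd in auto)
  qed
  then show thesis
    using that[of "Blinfun l"] l by (simp add: bounded_linear_Blinfun_apply)
qed

text \<open>The ultrafilter limit of the uniform distributions on sign patterns of length
  \<open>N\<close>. It measures every set but is only finitely additive: singletons have density 0,
  while the countably many finite sets together have density 1.\<close>

definition sign_density :: "nat set set \<Rightarrow> real" where
  "sign_density A = Lim nat_ultra (\<lambda>N. card (A \<inter> Pow {..<N}) / 2 ^ N)"

lemma card_Int_Pow_le: "card (A \<inter> Pow {..<N::nat}) / 2 ^ N \<le> (1::real)"
proof -
  have "card (A \<inter> Pow {..<N}) \<le> card (Pow {..<N})" by (rule card_mono) auto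
  also have "\<dots> = 2 ^ N" by (simp add: card_Pow)
  finally have "real (card (A \<inter> Pow {..<N})) \<le> real (2 ^ N)" by (rule of_nat_mono)
  then show ?thesis by simp
qed

lemma tendsto_sign_density:
  "((\<lambda>N. card (A \<inter> Pow {..<N}) / 2 ^ N) \<longlongrightarrow> sign_density A) nat_ultra"
  unfolding sign_density_def by (rule bounded_tendsto_nat_ultra[of _ 1]) (use card_Int_Pow_le in simp)

interpretation sign_density: finitely_additive sign_density
proof
  fix A B :: "nat set set"
  show "sign_density A \<ge> 0"
    using tendsto_sign_density[of A] by (rule tendsto_lowerbound) simp_all
  show "sign_density A \<le> 1"
    using tendsto_sign_density[of A] by (rule tendsto_upperbound) (use card_Int_Pow_le in simp_all)
  assume AB: "A \<inter> B = {}"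
  have "card ((A \<union> B) \<inter> Pow {..<N}) = card (A \<inter> Pow {..<N}) + card (B \<inter> Pow {..<N})" for N :: nat
    using AB by (subst card_Un_disjoint[symmetric]) (auto simp: Int_Un_distrib2)
  then have "(\<lambda>N. card ((A \<union> B) \<inter> Pow {..<N}) / 2 ^ N :: real) =
      (\<lambda>N. card (A \<inter> Pow {..<N}) / 2 ^ N + card (B \<inter> Pow {..<N}) / 2 ^ N)"
    by (simp add: add_divide_distrib)
  then show "sign_density (A \<union> B) = sign_density A + sign_density B"
    using tendsto_sign_density[of "A \<union> B"] tendsto_add[OF tendsto_sign_density[of A] tendsto_sign_density[of B]]
    by (auto intro: tendsto_unique[OF nat_ultra_nontrivial])
qed

text \<open>This plays the role of the dominated convergence theorem: if the averages of \<open>\<bar>g t z\<bar>\<close> stay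
  away from 0, then infinitely many \<open>z k\<close> are simultaneously large at a weak* limit of the \<open>g t\<close>.\<close>
lemma large_sign_averages_imp_common_functional:
  fixes g :: "nat set \<Rightarrow> 'a::real_normed_vector \<Rightarrow>\<^sub>L real"
  assumes g: "\<And>t. norm (g t) \<le> C" and D: "\<And>t k. \<bar>g t (z k)\<bar> \<le> D" and c: "c > 0"
    and large: "\<And>k. \<forall>\<^sub>F N in nat_ultra. c \<le> (\<Sum>t\<in>Pow {..<N}. \<bar>g t (z k)\<bar>) / 2 ^ N"
  obtains h :: "'a \<Rightarrow>\<^sub>L real" and s t where "strict_mono (s :: nat \<Rightarrow> nat)" "\<And>k::nat. finite (t k)"
    "\<And>x. ((\<lambda>k. g (t k) x) \<longlongrightarrow> h x) nat_ultra" "\<And>i. \<bar>h (z (s i))\<bar> \<ge> c / 2"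
proof -
  \<comment> \<open>Restriction to finite \<open>t\<close> loses nothing, as
    \<open>Pow {..<N}\<close> consists of finite sets; it confines the functionals chosen later to a
    countable family.\<close>
  define A where "A k = {t. finite t \<and> \<bar>g t (z k)\<bar> \<ge> c / 2}" for k
  have D0: "D \<ge> 0" using D[of "{}" 0] by linarith
  \<comment> \<open>A Markov type estimate: an average of at least \<open>c\<close>, with values at
    most \<open>D\<close> on \<open>A k\<close> and below \<open>c / 2\<close> elsewhere, forces
    \<open>c / 2\<close> to be at most \<open>D\<close> times the proportion of
    \<open>A k\<close>.\<close>
  have "c / (2 * (D + 1)) \<le> sign_density (A k)" for k
    using tendsto_sign_density
  proof (rule tendsto_lowerbound)
    show "\<forall>\<^sub>F N in nat_ultra. c / (2 * (D + 1)) \<le> real (card (A k \<inter> Pow {..<N})) / 2 ^ N"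
      using large[of k]
    proof eventually_elim
      case (elim N)
      have "(\<Sum>t\<in>Pow {..<N}. \<bar>g t (z k)\<bar>) \<le> (\<Sum>t\<in>Pow {..<N}. c / 2 + (if t \<in> A k then D else 0))"
        using D c by (intro sum_mono) (auto simp: A_def finite_subset not_le intro: add_increasing less_imp_le)
      also have "\<dots> = 2 ^ N * (c / 2) + real (card (A k \<inter> Pow {..<N})) * D"
        by (simp add: sum.distrib card_Pow Int_commute flip: sum.inter_restrict)
      finally have "(\<Sum>t\<in>Pow {..<N}. \<bar>g t (z k)\<bar>) / 2 ^ N \<le> (2 ^ N * (c / 2) + real (card (A k \<inter> Pow {..<N})) * D) / 2 ^ N"
        by (intro divide_right_mono) simp_all
      also have "\<dots> = c / 2 + real (card (A k \<inter> Pow {..<N})) / 2 ^ N * D"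
        by (simp add: field_simps)
      finally have "c / 2 \<le> real (card (A k \<inter> Pow {..<N})) / 2 ^ N * D"
        using elim by linarith
      also have "\<dots> \<le> real (card (A k \<inter> Pow {..<N})) / 2 ^ N * (D + 1)"
        by (intro mult_left_mono) auto
      finally have "c / 2 \<le> real (card (A k \<inter> Pow {..<N})) / 2 ^ N * (D + 1)" .
      moreover have "c / (2 * (D + 1)) \<le> m" if "c / 2 \<le> m * (D + 1)" for m
        using that D0 by (simp add: field_simps)
      ultimately show ?case by blast
    qed
  qed simp
  then obtain s where s: "strict_mono (s :: nat \<Rightarrow> nat)" "\<And>k::nat. (\<Inter>i<k. A (s i)) \<noteq> {}"
    using sign_density.infinite_subfamily_fip[of "c / (2 * (D + 1))" A] c D0 by auto
  \<comment> \<open>With \<open>Suc k\<close> sets, \<open>t k\<close> lies in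
    \<open>A (s i)\<close> for all \<open>i \<le> k\<close>, so the ultrafilter limit inherits the
    bound at every \<open>z (s i)\<close>.\<close>
  have "\<exists>t. t \<in> (\<Inter>i<Suc k. A (s i))" for k
    using s(2)[of "Suc k"] by blast
  then obtain t where t: "\<And>k. t k \<in> (\<Inter>i<Suc k. A (s i))" by metis
  obtain h :: "'a \<Rightarrow>\<^sub>L real" where h: "\<And>x. ((\<lambda>k. g (t k) x) \<longlongrightarrow> h x) nat_ultra"
    using ultra_limit_blinfun[of "\<lambda>k. g (t k)" C] g by blast
  have tA: "t k \<in> A (s i)" if "i \<le> k" for i k
    using t[of k] that by auto
  have "\<bar>h (z (s i))\<bar> \<ge> c / 2" for i
    using tendsto_rabs[OF h[of "z (s i)"]]
  proof (rule tendsto_lowerbound)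
    have "\<forall>\<^sub>F k in nat_ultra. k \<ge> i"
      by (rule eventually_nat_ultraI[OF eventually_ge_at_top])
    then show "\<forall>\<^sub>F k in nat_ultra. c / 2 \<le> \<bar>g (t k) (z (s i))\<bar>"
      by eventually_elim (use tA in \<open>auto simp: A_def\<close>)
  qed simp
  moreover have "finite (t k)" for k using tA[of k k] by (simp add: A_def)
  ultimately show thesis using that s(1) h by blast
qed

text \<open>The finite sets are enumerated by \<open>set_decode\<close>. At stage \<open>k\<close>
  closeness to the ultrafilter limit is required for the first \<open>k + 1\<close> functionals
  only, and convergence is obtained on this countable family.\<close>

lemma weakly_compact_subsequence:
  fixes g :: "nat set \<Rightarrow> 'a::real_normed_vector \<Rightarrow>\<^sub>L real"
  assumes K: "compactin weak_topology K" and x: "\<And>n. x n \<in> K"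
  obtains y q where "y \<in> K" "strict_mono (q :: nat \<Rightarrow> nat)" "\<And>t. finite t \<Longrightarrow> (\<lambda>k. g t (x (q k))) \<longlonglongrightarrow> g t y"
proof -
  obtain y where y: "y \<in> K" "\<And>f :: 'a \<Rightarrow>\<^sub>L real. ((\<lambda>n. f (x n)) \<longlongrightarrow> f y) nat_ultra"
    by (rule weakly_compact_ultra_limit[of K x, OF K x]) blast
  have "\<exists>\<^sub>F n in sequentially. \<forall>i\<in>{..k}. dist (g (set_decode i) (x n)) (g (set_decode i) y) < 1 / real (Suc k)" for k
  proof (intro eventually_nat_ultra_frequently eventually_ball_finite ballI)
    show "\<forall>\<^sub>F n in nat_ultra. dist (g (set_decode i) (x n)) (g (set_decode i) y) < 1 / real (Suc k)" for i
      using y(2)[of "g (set_decode i)"] by (rule tendstoD) simp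
  qed simp
  then obtain q where q: "strict_mono (q :: nat \<Rightarrow> nat)"
    "\<And>k. \<forall>i\<in>{..k}. dist (g (set_decode i) (x (q k))) (g (set_decode i) y) < 1 / real (Suc k)"
    by (rule frequently_subseq[of "\<lambda>k n. \<forall>i\<in>{..k}. dist (g (set_decode i) (x n)) (g (set_decode i) y) < 1 / real (Suc k)"]) blast
  have "(\<lambda>k. g t (x (q k))) \<longlonglongrightarrow> g t y" if t: "finite t" for t
  proof -
    define i where "i = set_encode t"
    have ti: "set_decode i = t" unfolding i_def using t by simp
    have "(\<lambda>k. g t (x (q k)) - g t y) \<longlonglongrightarrow> 0"
    proof (rule Lim_null_comparison[OF _ LIMSEQ_inverse_real_of_nat])
      show "\<forall>\<^sub>F k in sequentially. norm (g t (x (q k)) - g t y) \<le> inverse (real (Suc k))"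
        using eventually_ge_at_top[of i]
      proof eventually_elim
        case (elim k)
        then show ?case using q(2)[of k] ti by (force simp: dist_real_def inverse_eq_divide)
      qed
    qed
    then show ?thesis by (rule LIM_zero_cancel)
  qed
  with y(1) q(1) that show thesis by blast
qed

text \<open>Bessel's inequality gives pointwise convergence to 0. If uniformity fails at points of
  \<open>K\<close>, subtracting a limit \<open>y\<close> leaves vectors \<open>z k\<close> with
  large averages, so some limit \<open>h\<close> of functionals \<open>g (t k)\<close> is large at
  infinitely many \<open>z k\<close>. Yet the limit \<open>y'\<close> of the corresponding points
  cannot be distinguished from \<open>y\<close> by any \<open>g u\<close> with \<open>u\<close>
  finite, nor therefore by \<open>h\<close>.\<close>

lemma sign_averages_uniformly_null:
  fixes g :: "nat set \<Rightarrow> 'a::real_normed_vector \<Rightarrow>\<^sub>L real" and f :: "nat \<Rightarrow> 'a \<Rightarrow>\<^sub>L real"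
  assumes g: "\<And>t. norm (g t) \<le> C"
    and f: "\<And>n x. ((\<lambda>N. (\<Sum>t\<in>Pow {..<N}. sgn_of t n * g t x) / 2 ^ N) \<longlongrightarrow> f n x) nat_ultra"
    and K: "compactin weak_topology K"
  shows "uniform_limit K (\<lambda>n. blinfun_apply (f n)) (\<lambda>_. 0) sequentially"
proof -
  have C0: "C \<ge> 0" using g[of "{}"] norm_ge_zero order_trans by blast
  have gx: "\<bar>g t x\<bar> \<le> C * norm x" for t x
    using norm_blinfun[of "g t" x] mult_right_mono[OF g[of t] norm_ge_zero[of x]] by simp
  have f0: "(\<lambda>n. f n x) \<longlonglongrightarrow> 0" for x
  proof -
    have "(\<Sum>n<M. (f n x)\<^sup>2) \<le> (C * norm x)\<^sup>2" for M
    proof (rule tendsto_upperbound)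
      show "((\<lambda>N. \<Sum>n<M. ((\<Sum>t\<in>Pow {..<N}. sgn_of t n * g t x) / 2 ^ N)\<^sup>2) \<longlongrightarrow> (\<Sum>n<M. (f n x)\<^sup>2)) nat_ultra"
        by (intro tendsto_sum tendsto_power f)
      have "\<forall>\<^sub>F N in nat_ultra. N \<ge> M"
        by (rule eventually_nat_ultraI[OF eventually_ge_at_top])
      then show "\<forall>\<^sub>F N in nat_ultra. (\<Sum>n<M. ((\<Sum>t\<in>Pow {..<N}. sgn_of t n * g t x) / 2 ^ N)\<^sup>2) \<le> (C * norm x)\<^sup>2"
        by eventually_elim (rule bessel_signs[OF gx])
    qed simp
    then have "summable (\<lambda>n. (f n x)\<^sup>2)"
      by (intro bounded_imp_summable[of _ "(C * norm x)\<^sup>2"]) (simp_all flip: lessThan_Suc_atMost del: sum.lessThan_Suc)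
    then have "(\<lambda>n. sqrt ((f n x)\<^sup>2)) \<longlonglongrightarrow> sqrt 0"
      by (intro tendsto_real_sqrt summable_LIMSEQ_zero)
    then show ?thesis by (simp add: tendsto_rabs_zero_iff)
  qed
  have avg: "\<forall>\<^sub>F N in nat_ultra. c \<le> (\<Sum>t\<in>Pow {..<N}. \<bar>g t x\<bar>) / 2 ^ N" if "c < \<bar>f n x\<bar>" for c n x
  proof -
    have "\<forall>\<^sub>F N in nat_ultra. c < \<bar>(\<Sum>t\<in>Pow {..<N}. sgn_of t n * g t x) / 2 ^ N\<bar>"
      using tendsto_rabs[OF f[of n x]] that by (rule order_tendstoD)
    then show ?thesis
    proof eventually_elim
      case (elim N)
      have "\<bar>\<Sum>t\<in>Pow {..<N}. sgn_of t n * g t x\<bar> \<le> (\<Sum>t\<in>Pow {..<N}. \<bar>g t x\<bar>)"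
        by (rule order_trans[OF sum_abs]) (simp add: abs_mult)
      then have "\<bar>\<Sum>t\<in>Pow {..<N}. sgn_of t n * g t x\<bar> / 2 ^ N \<le> (\<Sum>t\<in>Pow {..<N}. \<bar>g t x\<bar>) / 2 ^ N"
        by (rule divide_right_mono) simp
      with elim show ?case by simp
    qed
  qed
  show ?thesis
  proof (rule uniform_limitI, rule ccontr)
    fix e :: real assume e: "e > 0"
    assume "\<not> (\<forall>\<^sub>F n in sequentially. \<forall>x\<in>K. dist (f n x) 0 < e)"
    then have "\<exists>\<^sub>F n in sequentially. \<not> (\<forall>x\<in>K. dist (f n x) 0 < e)"
      by (simp add: not_eventually)
    then obtain r where r: "strict_mono (r :: nat \<Rightarrow> nat)" "\<And>k. \<not> (\<forall>x\<in>K. dist (f (r k)x) 0 < e)"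
      by (rule frequently_subseq1) blast
    then have "\<exists>x. x \<in> K \<and> \<bar>f (r k) x\<bar> \<ge> e" for k
      using r(2)[of k] by (auto simp: not_less)
    then obtain x where x: "\<And>k. x k \<in> K" "\<And>k. \<bar>f (r k) (x k)\<bar> \<ge> e" by metis
    obtain y q where y: "y \<in> K" and q: "strict_mono (q :: nat \<Rightarrow> nat)"
      "\<And>t. finite t \<Longrightarrow> (\<lambda>k. g t (x (q k))) \<longlonglongrightarrow> g t y"
      by (rule weakly_compact_subsequence[of K x g, OF K x(1)]) blast
    have "strict_mono (\<lambda>k. r (q k))" using strict_mono_o[OF r(1) q(1)] by (simp add: o_def)
    then have "(\<lambda>k. f (r (q k)) y) \<longlonglongrightarrow> 0"
      using LIMSEQ_subseq_LIMSEQ[OF f0] by (fastforce simp: o_def)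
    then have "\<forall>\<^sub>F k in sequentially. \<bar>f (r (q k)) y\<bar> < e / 2"
      by (rule tendsto_zero_eventually_less) (use e in simp)
    \<comment> \<open>Discarding finitely many terms makes the value at \<open>y\<close> at most
      half of the value at the bad point, so subtracting \<open>y\<close> keeps the averages
      large.\<close>
    then obtain k0 where k0: "\<And>k. k \<ge> k0 \<Longrightarrow> \<bar>f (r (q k)) y\<bar> < e / 2"
      by (auto simp: eventually_sequentially)
    define z where "z k = x (q (k0 + k)) - y" for k
    obtain B where B: "B \<ge> 0" "\<And>x f. x \<in> K \<Longrightarrow> \<bar>blinfun_apply f x\<bar> \<le> B * norm (f :: 'a \<Rightarrow>\<^sub>L real)"
      by (rule weakly_compact_bounded[OF K]) blast
    have gK: "\<bar>g t v\<bar> \<le> B * C" if "v \<in> K" for t v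
      using B(2)[OF that, of "g t"] mult_left_mono[OF g[of t] B(1)] by linarith
    have D: "\<bar>g t (z k)\<bar> \<le> B * C + B * C" for t k
      using gK[OF x(1)[of "q (k0 + k)"], of t] gK[OF y, of t]
      unfolding z_def by (simp add: blinfun.diff_right)
    have large: "\<forall>\<^sub>F N in nat_ultra. e / 4 \<le> (\<Sum>t\<in>Pow {..<N}. \<bar>g t (z k)\<bar>) / 2 ^ N" for k
    proof (rule avg)
      have "\<bar>f (r (q (k0 + k))) (x (q (k0 + k)))\<bar> \<ge> e" "\<bar>f (r (q (k0 + k))) y\<bar> < e / 2"
        using x(2) k0[of "k0 + k"] by auto
      moreover have "e / 4 < \<bar>a - b\<bar>" if "\<bar>a\<bar> \<ge> e" "\<bar>b\<bar> < e / 2" for a b :: real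
        using that e by linarith
      ultimately show "e / 4 < \<bar>f (r (q (k0 + k))) (z k)\<bar>"
        unfolding z_def blinfun.diff_right by blast
    qed
    obtain h :: "'a \<Rightarrow>\<^sub>L real" and s t where s: "strict_mono (s :: nat \<Rightarrow> nat)" and t: "\<And>k::nat. finite (t k)"
      and h: "\<And>x. ((\<lambda>k. g (t k) x) \<longlongrightarrow> h x) nat_ultra" "\<And>i. \<bar>h (z (s i))\<bar> \<ge> e / 4 / 2"
      by (rule large_sign_averages_imp_common_functional[of g C z "B * C + B * C" "e / 4", OF g D _ large]) (use e in auto)
    \<comment> \<open>The point \<open>y\<close> was a limit on the countable family only, so a weak
      limit point along \<open>s\<close> is taken anew; it serves to evaluate
      \<open>h\<close>.\<close>
    obtain y' where y': "\<And>f :: 'a \<Rightarrow>\<^sub>L real. ((\<lambda>i. f (x (q (k0 + s i)))) \<longlongrightarrow> f y') nat_ultra"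
      by (rule weakly_compact_ultra_limit[OF K, of "\<lambda>i. x (q (k0 + s i))"]) (use x(1) in auto)
    have "g u y' = g u y" if u: "finite u" for u
    proof -
      have "strict_mono (\<lambda>i. k0 + s i)" using s by (simp add: strict_mono_def)
      then have "(\<lambda>i. g u (x (q (k0 + s i)))) \<longlonglongrightarrow> g u y"
        using LIMSEQ_subseq_LIMSEQ[OF q(2)[OF u]] by (fastforce simp: o_def)
      then have "((\<lambda>i. g u (x (q (k0 + s i)))) \<longlongrightarrow> g u y) nat_ultra"
        by (rule tendsto_mono[OF nat_ultra(1)])
      with y'[of "g u"] show ?thesis by (rule tendsto_unique[OF nat_ultra_nontrivial])
    qed
    then have "(\<lambda>k. g (t k) y') = (\<lambda>k. g (t k) y)" using t by auto
    then have hy: "h y' = h y"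
      using h(1)[of y] h(1)[of y'] by (auto intro: tendsto_unique[OF nat_ultra_nontrivial])
    have "((\<lambda>i. \<bar>h (x (q (k0 + s i))) - h y\<bar>) \<longlongrightarrow> \<bar>h y' - h y\<bar>) nat_ultra"
      by (intro tendsto_intros y')
    then have "e / 4 / 2 \<le> \<bar>h y' - h y\<bar>"
      by (rule tendsto_lowerbound) (use h(2) in \<open>simp_all add: z_def blinfun.diff_right\<close>)
    then show False using e hy by simp
  qed
qed

text \<open>Both bounds come from continuity at 0 by scaling. For the lower one \<open>S\<close> is
  evaluated only at \<open>T\<close> of multiples of \<open>a\<close>, where it returns that
  multiple.\<close>

lemma contains_ell1E:
  assumes "contains_ell1 TYPE('a::real_normed_vector)"
  obtains T :: "ell1 \<Rightarrow> 'a::real_normed_vector" and B C where "linear T" "\<And>a. norm (T a) \<le> B * norm a" "\<And>a. norm a \<le> C * norm (T a)" "C > 0"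
proof -
  obtain Y :: "'a set" and T S where T: "linear T" and hom: "homeomorphism UNIV Y (T :: ell1 \<Rightarrow> 'a) S"
    using assms unfolding contains_ell1_def by blast
  have ST: "S (T a) = a" for a using hom by (simp add: homeomorphism_def)
  have TY: "T a \<in> Y" for a using hom by (auto simp: homeomorphism_def)
  have T0: "T 0 = 0" by (rule linear_0[OF T])
  have "continuous_on UNIV T" using hom by (simp add: homeomorphism_def)
  then obtain d where d: "d > 0" "\<And>a. norm a < d \<Longrightarrow> norm (T a) < 1"
    unfolding continuous_on_iff using T0 by (metis UNIV_I diff_zero dist_norm zero_less_one)
  have "continuous_on Y S" using hom by (simp add: homeomorphism_def)
  then obtain c where c: "c > 0" "\<And>v. v \<in> Y \<Longrightarrow> norm v < c \<Longrightarrow> norm (S v) < 1"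
    unfolding continuous_on_iff using TY[of 0] ST[of 0] T0 by (metis diff_zero dist_norm zero_less_one)
  have "norm (T a) \<le> 2 / d * norm a" for a
  proof (cases "a = 0")
    case False
    have "norm (T ((d / (2 * norm a)) *\<^sub>R a)) < 1" using d(1) False by (intro d(2)) simp
    then show ?thesis using d(1) False by (simp add: linear_cmul[OF T] field_simps)
  qed (simp add: T0)
  moreover have "norm a \<le> 2 / c * norm (T a)" for a
  proof (cases "T a = 0")
    case True
    then have "a = 0" using ST[of a] ST[of 0] T0 by simp
    then show ?thesis using True by simp
  next
    case False
    let ?b = "(c / (2 * norm (T a))) *\<^sub>R a"
    have "norm (S (T ?b)) < 1"
      using c(1) False by (intro c(2) TY) (simp add: linear_cmul[OF T])
    then show ?thesis using c(1) False by (simp add: ST field_simps)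
  qed
  ultimately show thesis using that[of T "2 / d" "2 / c"] T c(1) by auto
qed

definition ell1_unit :: "nat \<Rightarrow> ell1" where
  "ell1_unit k = Abs_ell1 (\<lambda>n. if n = k then 1 else 0)"

lemma ell1_unit_nth: "ell1_nth (ell1_unit k) = (\<lambda>n. if n = k then 1 else 0)"
proof -
  have "summable (\<lambda>n. \<bar>if n = k then 1 else 0 :: real\<bar>)"
    by (rule summable_finite[of "{k}"]) auto
  then show ?thesis unfolding ell1_unit_def by (simp add: Abs_ell1_inverse)
qed

lemma ell1_unit_sums: "(\<Sum>n. ell1_nth (ell1_unit k) n *\<^sub>R x n) = (x k :: 'a::real_normed_vector)"
proof -
  have "(\<lambda>n. ell1_nth (ell1_unit k) n *\<^sub>R x n) = (\<lambda>n. if n = k then x n else 0)"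
    by (auto simp: ell1_unit_nth)
  then show ?thesis using sums_unique[OF sums_single[of k x]] by simp
qed

lemma norm_ell1_unit_le: "norm (ell1_unit k) \<le> 1"
proof (rule norm_ell1_leI)
  show "(\<Sum>i<n. \<bar>ell1_nth (ell1_unit k) i\<bar>) \<le> 1" for n
    by (simp add: ell1_unit_nth if_distrib cong: if_cong)
qed

theorem sequentially_reflexive_imp_no_ell1:
  assumes refl: "sequentially_reflexive TYPE('a::banach)"
  shows "\<not> contains_ell1 TYPE('a)"
proof
  assume "contains_ell1 TYPE('a)"
  then obtain T :: "ell1 \<Rightarrow> 'a" and B C where T: "linear T" "\<And>a. norm (T a) \<le> B * norm a"
    "\<And>a. norm a \<le> C * norm (T a)" and C: "C > 0"
    by (rule contains_ell1E) blast
  have "\<exists>g :: 'a \<Rightarrow>\<^sub>L real. norm g \<le> C \<and> (\<forall>n. blinfun_apply g (T (ell1_unit n)) = sgn_of t n)" for t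
  proof -
    \<comment> \<open>A sign sequence is a functional of norm at most 1 on \<open>ell1\<close>; the
      lower bound of \<open>T\<close> gives extensions whose norm bound \<open>C\<close> is the same
      for all \<open>t\<close>.\<close>
    let ?\<phi> = "\<lambda>a. \<Sum>n. ell1_nth a n *\<^sub>R sgn_of t n"
    have lin: "linear ?\<phi>"
      using bounded_linear_ell1_sum(1)[of "sgn_of t" 1] by (simp add: bounded_linear.linear)
    have "?\<phi> a \<le> C * norm (T a)" for a
      using bounded_linear_ell1_sum(2)[of "sgn_of t" 1 a] T(3)[of a] by simp
    from hahn_banach_along[OF T(1) lin this] C obtain g :: "'a \<Rightarrow>\<^sub>L real"
      where "norm g \<le> C" "\<And>a. g (T a) = ?\<phi> a" by auto
    then show ?thesis using ell1_unit_sums[of _ "sgn_of t"] by auto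
  qed
  then obtain g :: "nat set \<Rightarrow> 'a \<Rightarrow>\<^sub>L real" where g: "\<And>t. norm (g t) \<le> C" "\<And>t n. g t (T (ell1_unit n)) = sgn_of t n"
    by metis
  have "\<exists>f :: 'a \<Rightarrow>\<^sub>L real. \<forall>x. ((\<lambda>N. (\<Sum>t\<in>Pow {..<N}. sgn_of t n * g t x) / 2 ^ N) \<longlongrightarrow> blinfun_apply f x) nat_ultra" for n
  proof -
    define G where "G N = (1 / 2 ^ N) *\<^sub>R (\<Sum>t\<in>Pow {..<N}. sgn_of t n *\<^sub>R g t)" for N :: nat
    have "norm (G N) \<le> C" for N
    proof -
      have "norm (\<Sum>t\<in>Pow {..<N}. sgn_of t n *\<^sub>R g t) \<le> (\<Sum>t\<in>Pow {..<N}. C)"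
        by (rule sum_norm_le) (use g(1) in simp)
      then show ?thesis unfolding G_def by (simp add: card_Pow field_simps)
    qed
    then obtain f :: "'a \<Rightarrow>\<^sub>L real" where "\<And>x. ((\<lambda>N. G N x) \<longlongrightarrow> f x) nat_ultra"
      by (rule ultra_limit_blinfun[of G]) blast
    moreover have "G N x = (\<Sum>t\<in>Pow {..<N}. sgn_of t n * g t x) / 2 ^ N" for N x
      by (simp add: G_def blinfun.scaleR_left blinfun.sum_left)
    ultimately show ?thesis by auto
  qed
  then obtain f :: "nat \<Rightarrow> 'a \<Rightarrow>\<^sub>L real" where
    f: "\<And>n x. ((\<lambda>N. (\<Sum>t\<in>Pow {..<N}. sgn_of t n * g t x) / 2 ^ N) \<longlongrightarrow> f n x) nat_ultra"
    by metis
  have f1: "f n (T (ell1_unit n)) = 1" for n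
    using f[of n "T (ell1_unit n)"] by (simp add: g(2) card_Pow tendsto_const_iff)
  have lim: "limitin mackey_topology f 0 sequentially"
    unfolding limitin_mackey_topology
    using sign_averages_uniformly_null[OF g(1) f] by (auto simp: zero_blinfun.rep_eq)
  then obtain l where l: "f \<longlonglongrightarrow> l"
    using refl unfolding sequentially_reflexive_def convergent_def by blast
  \<comment> \<open>Norm and Mackey convergence both imply pointwise convergence, so the norm limit
    must be the Mackey limit 0, although \<open>f n\<close> equals 1 at the bounded vectors
    \<open>T (ell1_unit n)\<close>.\<close>
  have "l x = 0" for x
    using tendsto_unique[OF _ blinfun.tendsto[OF l tendsto_const[of x]] limitin_mackey_pointwise[OF lim, of x]] by simp
  then have "l = 0" by (intro blinfun_eqI) simp
  define B' where "B' = \<bar>B\<bar> + 1"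
  have "B' > 0" unfolding B'_def by simp
  have Te: "norm (T (ell1_unit n)) \<le> B'" for n
  proof -
    have "norm (T (ell1_unit n)) \<le> \<bar>B\<bar> * norm (ell1_unit n)"
      by (rule order_trans[OF T(2)]) (simp add: mult_right_mono)
    also have "\<dots> \<le> \<bar>B\<bar> * 1" by (rule mult_left_mono[OF norm_ell1_unit_le]) simp
    finally show ?thesis unfolding B'_def by simp
  qed
  have "\<forall>\<^sub>F n in sequentially. norm (f n) < 1 / B'"
    using tendstoD[OF l, of "1 / B'"] \<open>B' > 0\<close> \<open>l = 0\<close> by simp
  then obtain n where n: "norm (f n) < 1 / B'" by (auto simp: eventually_sequentially)
  have "1 \<le> norm (f n) * norm (T (ell1_unit n))"
    using norm_blinfun[of "f n" "T (ell1_unit n)"] by (simp add: f1)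
  also have "\<dots> \<le> norm (f n) * B'" by (rule mult_left_mono[OF Te]) simp
  also have "\<dots> < 1" using n \<open>B' > 0\<close> by (simp add: field_simps)
  finally show False by simp
qed

theorem corollary3p5:
  shows "(\<not> contains_ell1 TYPE('a::banach) \<longleftrightarrow> sequentially_reflexive TYPE('a)) \<and>
    (\<not> contains_ell1 TYPE('a) \<longrightarrow>
       angelic_space (mackey_topology :: ('a \<Rightarrow>\<^sub>L real) topology))"
  using no_ell1_imp_sequentially_reflexive sequentially_reflexive_imp_no_ell1
    no_ell1_imp_angelic_mackey by blast

end
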